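(* Let $i,k$ be integers with $0\le k\le i-1$. Consider the set of all invariant subspaces (in the sense of the context: the simultaneous eigenspaces $V_\chi$) of the preimages $S\subseteq E$ of all $(i-k)$-dimensional totally singular subspaces $\bar S$ of $\bar E$. This set is a packing of $N$ (distinct) planes in $G(2^i,2^k)$ with minimal distance $d=2^{(k-1)/2}$, where $$N=2^{i-k}\begin{bmatrix} i\\ k\end{bmatrix}\prod_{j=k}^{i-1}(2^j+1),\qquad \begin{bmatrix} i\\ k\end{bmatrix}=\frac{(2^i-1)(2^{i-1}-1)\cdots(2^{i-k+1}-1)}{(2^k-1)(2^{k-1}-1)\cdots(2-1)}$$ (a Gaussian binomial coefficient, equal to $1$ for $k=0$).
   Context: **Grassmannian packings.** $G(m,n)$ is the set of $n$-dimensional linear subspaces ("planes") of $\mathbb{R}^m$. The distance between $P,Q\in G(m,n)$ is $d(P,Q)=\sqrt{\sin^2\theta_1+\dots+\sin^2\theta_n}$, where $\theta_1,\dots,\theta_n$ are the principal angles between $P$ and $Q$; equivalently $d^2(P,Q)=n-\operatorname{trace}(\Pi_P\Pi_Q)$, where $\Pi_P,\Pi_Q$ are the orthogonal projection matrices onto $P,Q$. A packing of $N$ planes is a subset $\mathcal P=\{P_1,\dots,P_N\}\subset G(m,n)$ of $N$ planes; its minimal distance is $d(\mathcal P)=\min_{a\ne b}d(P_a,P_b)$. **The group $E$ and the orthogonal space $\bar E$.** Let $i\ge 1$, $U=\mathbb{F}_2^i$ with the usual dot product, and let $V=\mathbb{R}^{2^i}$ with orthonormal basis $(e_u)_{u\in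 U}$. For $a,b\in U$ define orthogonal transformations of $V$ by $X(a):e_u\mapsto e_{u+a}$ and $Y(b):e_u\mapsto(-1)^{b\cdot u}e_u$. Let $E=\{\pm X(a)Y(b):a,b\in U\}$, the group generated by all $X(a)$ and $Y(b)$; it has order $2^{2i+1}$ and center $\{\pm I\}$. Put $\bar E=E/\{\pm I\}$, an elementary abelian $2$-group of order $2^{2i}$, regarded as a $2i$-dimensional vector space over $\mathbb{F}_2$. Define the quadratic form $Q:\bar E\to\mathbb{F}_2$ by $Q(\bar g)=0$ if $g^2=I$ and $Q(\bar g)=1$ if $g^2=-I$, where $g\in E$ is any preimage of $\bar g$; thus $Q(\overline{X(a)Y(b)})=a\cdot b$. A subspace $\bar S\subseteq\bar E$ is totally singular if $Q(\bar g)=0$ for all $\bar g\in\bar S$. **Invariant subspaces.** If $\bar S\subseteq\bar E$ is a totally singular subspace of dimension $r$, its preimage $S\subseteq E$ (which contains $-I$) is an elementary abelian $2$-group of order $2^{r+1}$. The invariant subspaces of $S$ are the simultaneous eigenspaces $V_\chi=\{v\in V: gv=\chi(g)v\ \text{for all } g\in S\}$, where $\chi$ runs over the $2^r$ characters $\chi:S\to\{\pm1\}$ with $\chi(-I)=-1$. They are $2^r$ mutually orthogonal subspaces of $V$, each of dimension $2^{i-r}$. *)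

theory Defs
  imports "HOL-Analysis.Analysis" "HOL-Library.Z2"
begin

definition grassmannian :: "nat \<Rightarrow> 'a::euclidean_space set set" where
  "grassmannian n = {P. subspace P \<and> dim P = n}"

text \<open>
  The principal angles between \<open>P\<close> and \<open>Q\<close>, for \<open>dim P = dim Q\<close>, by the usual recursion:
  \<open>\<theta> j\<close> is the smallest angle between a unit vector of \<open>P\<close> and a unit vector of \<open>Q\<close> that are
  orthogonal to the previously chosen principal vectors \<open>u l\<close> and \<open>v l\<close>, respectively, and it is
  attained at \<open>u j\<close>, \<open>v j\<close>. Indices start at 0, and values \<open>\<theta> j\<close> with \<open>j \<ge> dim P\<close> are irrelevant.
\<close>

definition principal_angles :: "'a::euclidean_space set \<Rightarrow> 'a set \<Rightarrow> (nat \<Rightarrow> real) \<Rightarrow> bool" where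
  "principal_angles P Q \<theta> \<longleftrightarrow>
    (\<exists>u v. \<forall>j<dim P.
       (let A = {x \<in> P. norm x = 1 \<and> (\<forall>l<j. u l \<bullet> x = 0)};
            B = {y \<in> Q. norm y = 1 \<and> (\<forall>l<j. v l \<bullet> y = 0)}
        in u j \<in> A \<and> v j \<in> B \<and> \<theta> j = arccos (u j \<bullet> v j) \<and>
           (\<forall>x\<in>A. \<forall>y\<in>B. \<theta> j \<le> arccos (x \<bullet> y))))"

text \<open>
  For subspaces of equal dimension, principal angles exist and are unique up to the irrelevant
  values, so the choice is immaterial.
\<close>

definition grass_dist :: "'a::euclidean_space set \<Rightarrow> 'a set \<Rightarrow> real" where
  "grass_dist P Q = (let \<theta> = (SOME \<theta>. principal_angles P Q \<theta>) in sqrt (\<Sum>j<dim P. (sin (\<theta> j))\<^sup>2))"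

definition is_packing :: "nat \<Rightarrow> 'a::euclidean_space set set \<Rightarrow> bool" where
  "is_packing n \<P> \<longleftrightarrow> finite \<P> \<and> \<P> \<subseteq> grassmannian n"

definition min_distance :: "'a::euclidean_space set set \<Rightarrow> real" where
  "min_distance \<P> = Min {grass_dist P Q | P Q. P \<in> \<P> \<and> Q \<in> \<P> \<and> P \<noteq> Q}"

text \<open>
  The type \<open>bit\<close> is the field with two elements, so \<open>bit ^ 'n\<close> is \<open>U\<close> with \<open>i = CARD('n)\<close>, and
  \<open>real ^ (bit ^ 'n)\<close> is \<open>V\<close>, with orthonormal basis \<open>axis u 1\<close>. Transformations of \<open>V\<close> are
  represented by their matrices with respect to this basis.
\<close>

instance bit :: finite
proof
  have "(UNIV :: bit set) \<subseteq> {0, 1}"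
    by auto
  then show "finite (UNIV :: bit set)"
    by (rule finite_subset) simp
qed

lemma CARD_bit: "CARD(bit) = 2"
proof -
  have "(UNIV :: bit set) = {0, 1}"
    by auto
  then show ?thesis
    by (metis card_2_iff zero_neq_one)
qed

lemma DIM_bit_space: "DIM(real ^ (bit ^ 'n)) = 2 ^ CARD('n)"
  by (simp add: CARD_bit)

declare add_bit_eq_xor [simp del] mult_bit_eq_and [simp del]

type_synonym 'n bitmat = "real ^ (bit ^ 'n) ^ (bit ^ 'n)"

definition bit_dot :: "bit ^ 'n \<Rightarrow> bit ^ 'n \<Rightarrow> bit" where
  "bit_dot a b = (\<Sum>j\<in>UNIV. a $ j * b $ j)"

definition bit_sign :: "bit \<Rightarrow> real" where
  "bit_sign c = (if c = 0 then 1 else - 1)"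

definition X_op :: "bit ^ 'n \<Rightarrow> 'n bitmat" where
  "X_op a = (\<chi> w u. if w = u + a then 1 else 0)"

definition Y_op :: "bit ^ 'n \<Rightarrow> 'n bitmat" where
  "Y_op b = (\<chi> w u. if w = u then bit_sign (bit_dot b u) else 0)"

lemma X_op_axis: "X_op a *v axis u 1 = axis (u + a) 1"
  by (subst vec_eq_iff, simp add: X_op_def matrix_vector_mult_basis column_def) (simp add: axis_def)

lemma Y_op_axis: "Y_op b *v axis u 1 = bit_sign (bit_dot b u) *\<^sub>R axis u 1"
  by (subst vec_eq_iff, simp add: Y_op_def matrix_vector_mult_basis column_def) (simp add: axis_def)

definition E_group :: "('n::finite) bitmat set" where
  "E_group = {g. \<exists>a b. g = X_op a ** Y_op b \<or> g = - (X_op a ** Y_op b)}"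

lemma bit_add_self [simp]: "x + x = (0 :: bit)"
  by (simp flip: mult_2)

lemma bitvec_add_self [simp]: "a + a = (0 :: bit ^ 'n)"
  by (simp add: vec_eq_iff)

lemma bit_dot_add_left: "bit_dot (a + b) c = bit_dot a c + bit_dot b c"
  by (simp add: bit_dot_def algebra_simps sum.distrib)

lemma bit_dot_add_right: "bit_dot a (b + c) = bit_dot a b + bit_dot a c"
  by (simp add: bit_dot_def algebra_simps sum.distrib)

lemma bit_sign_add: "bit_sign (x + y) = bit_sign x * bit_sign y"
  by (cases x; cases y) (simp_all add: bit_sign_def)

lemma bit_sign_cases: "bit_sign x = 1 \<or> bit_sign x = - 1"
  by (simp add: bit_sign_def)

lemma bitmat_eqI:
  fixes A B :: "'n::finite bitmat"
  assumes "\<And>u. A *v axis u 1 = B *v axis u 1"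
  shows "A = B"
  using assms by (simp add: matrix_vector_mult_basis column_def vec_eq_iff)

lemma XY_axis: "(X_op a ** Y_op b) *v axis u 1 = bit_sign (bit_dot b u) *\<^sub>R axis (u + a) 1"
  by (simp flip: matrix_vector_mul_assoc
      add: X_op_axis Y_op_axis matrix_vector_mult_scaleR)

lemma XY_mult:
  "(X_op a ** Y_op b) ** (X_op c ** Y_op d) =
     bit_sign (bit_dot b c) *\<^sub>R (X_op (a + c) ** Y_op (b + d))"
  by (rule bitmat_eqI)
    (simp flip: matrix_vector_mul_assoc scaleR_matrix_vector_assoc
      add: X_op_axis Y_op_axis matrix_vector_mult_scaleR bit_dot_add_left bit_dot_add_right
        bit_sign_add algebra_simps)

lemma X_op_0: "X_op 0 = mat 1"
  by (rule bitmat_eqI) (simp add: X_op_axis)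

lemma Y_op_0: "Y_op 0 = mat 1"
  by (rule bitmat_eqI) (simp add: Y_op_axis bit_dot_def bit_sign_def)

lemma E_group_iff:
  "g \<in> E_group \<longleftrightarrow> (\<exists>c a b. g = bit_sign c *\<^sub>R (X_op a ** Y_op b))"
proof
  assume "g \<in> E_group"
  then obtain a b where "g = X_op a ** Y_op b \<or> g = - (X_op a ** Y_op b)"
    by (auto simp: E_group_def)
  then have "g = bit_sign 0 *\<^sub>R (X_op a ** Y_op b) \<or> g = bit_sign 1 *\<^sub>R (X_op a ** Y_op b)"
    by (simp add: bit_sign_def)
  then show "\<exists>c a b. g = bit_sign c *\<^sub>R (X_op a ** Y_op b)"
    by blast
next
  assume "\<exists>c a b. g = bit_sign c *\<^sub>R (X_op a ** Y_op b)"
  then obtain c a b where "g = bit_sign c *\<^sub>R (X_op a ** Y_op b)"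
    by blast
  then have "g = X_op a ** Y_op b \<or> g = - (X_op a ** Y_op b)"
    by (simp add: bit_sign_def)
  then show "g \<in> E_group"
    unfolding E_group_def by blast
qed

lemma minus_in_E_group:
  assumes "g \<in> E_group"
  shows "- g \<in> E_group"
proof -
  obtain a b where "g = X_op a ** Y_op b \<or> g = - (X_op a ** Y_op b)"
    using assms by (auto simp: E_group_def)
  then have "- g = X_op a ** Y_op b \<or> - g = - (X_op a ** Y_op b)"
    by auto
  then show ?thesis
    unfolding E_group_def by blast
qed

lemma XY_in_E_group: "X_op a ** Y_op b \<in> E_group"
  unfolding E_group_def by blast

lemma X_op_in_E_group: "X_op a \<in> E_group"
  using XY_in_E_group[of a 0] by (simp add: Y_op_0)

lemma Y_op_in_E_group: "Y_op b \<in> E_group"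
  using XY_in_E_group[of 0 b] by (simp add: X_op_0)

lemma one_in_E_group: "mat 1 \<in> E_group"
  using X_op_in_E_group[of 0] by (simp add: X_op_0)

lemma scaleR_matrix_mult:
  fixes A B :: "'n::finite bitmat"
  shows "(s *\<^sub>R A) ** (t *\<^sub>R B) = (s * t) *\<^sub>R (A ** B)"
  by (simp add: matrix_matrix_mult_def vec_eq_iff sum_distrib_left algebra_simps)

lemma mult_in_E_group:
  assumes "g \<in> E_group" "h \<in> E_group"
  shows "g ** h \<in> E_group"
  using assms unfolding E_group_iff
  by (auto simp: scaleR_matrix_mult XY_mult simp flip: bit_sign_add) blast

lemma E_group_commute:
  assumes "g \<in> E_group" "h \<in> E_group"
  shows "h ** g = g ** h \<or> h ** g = - (g ** h)"
proof -
  obtain x a b y c d where gh: "g = bit_sign x *\<^sub>R (X_op a ** Y_op b)"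
      "h = bit_sign y *\<^sub>R (X_op c ** Y_op d)"
    using assms unfolding E_group_iff by blast
  show ?thesis
    unfolding gh scaleR_matrix_mult XY_mult
    by (auto simp: bit_sign_def add.commute)
qed

lemma E_group_square:
  assumes "g \<in> E_group"
  shows "g ** g = mat 1 \<or> g ** g = - mat 1"
proof -
  obtain x a b where g: "g = bit_sign x *\<^sub>R (X_op a ** Y_op b)"
    using assms unfolding E_group_iff by blast
  show ?thesis
    unfolding g scaleR_matrix_mult XY_mult
    by (auto simp: bit_sign_def X_op_0 Y_op_0)
qed

lemma E_group_mult_minus:
  fixes g h :: "'n::finite bitmat"
  shows "(- g) ** h = - (g ** h)" "g ** (- h) = - (g ** h)"
  using scaleR_matrix_mult[of "-1" g 1 h] scaleR_matrix_mult[of 1 g "-1" h] by simp_all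

definition ebar_rel :: "'n::finite bitmat \<Rightarrow> 'n bitmat \<Rightarrow> bool" where
  "ebar_rel g h \<longleftrightarrow> g \<in> E_group \<and> h \<in> E_group \<and> (h = g \<or> h = - g)"

quotient_type (overloaded) 'n ebar = "'n::finite bitmat" / partial: ebar_rel
proof (rule part_equivpI)
  show "\<exists>g::'n bitmat. ebar_rel g g"
    using one_in_E_group by (auto simp: ebar_rel_def)
  show "symp (ebar_rel :: 'n bitmat \<Rightarrow> _)"
    by (auto simp: symp_def ebar_rel_def)
  show "transp (ebar_rel :: 'n bitmat \<Rightarrow> _)"
    by (auto simp: transp_def ebar_rel_def)
qed

text \<open>
  The quotient group is written additively. Every element is its own inverse because
  \<open>g ** g\<close> is \<open>I\<close> or \<open>- I\<close>.
\<close>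

instantiation ebar :: (finite) ab_group_add
begin

lift_definition zero_ebar :: "'a ebar" is "mat 1"
  by (simp add: ebar_rel_def one_in_E_group)

lift_definition plus_ebar :: "'a ebar \<Rightarrow> 'a ebar \<Rightarrow> 'a ebar" is "\<lambda>g h. g ** h"
  by (auto simp: ebar_rel_def mult_in_E_group E_group_mult_minus)

definition uminus_ebar :: "'a ebar \<Rightarrow> 'a ebar" where
  "uminus_ebar x = x"

definition minus_ebar :: "'a ebar \<Rightarrow> 'a ebar \<Rightarrow> 'a ebar" where
  "minus_ebar x y = x + y"

instance
proof
  fix x y z :: "'a ebar"
  show "x + y + z = x + (y + z)"
    by transfer (auto simp: ebar_rel_def mult_in_E_group matrix_mul_assoc)
  show "x + y = y + x"
    by transfer (use E_group_commute in \<open>auto simp: ebar_rel_def mult_in_E_group\<close>)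
  show "0 + x = x"
    by transfer (auto simp: ebar_rel_def)
  show "- x + x = 0"
    unfolding uminus_ebar_def
  proof transfer
    fix x :: "'a bitmat"
    assume "ebar_rel x x"
    then have x: "x \<in> E_group"
      by (simp add: ebar_rel_def)
    then have "mat 1 = x ** x \<or> mat 1 = - (x ** x)"
      using E_group_square[OF x] by auto
    with x show "ebar_rel (x ** x) (mat 1)"
      by (simp add: ebar_rel_def mult_in_E_group one_in_E_group)
  qed
  show "x - y = x + - y"
    by (simp add: minus_ebar_def uminus_ebar_def)
qed

end

definition ebar_scale :: "bit \<Rightarrow> 'n::finite ebar \<Rightarrow> 'n ebar" where
  "ebar_scale c x = (if c = 0 then 0 else x)"

lemma ebar_add_self: "x + x = (0 :: 'n::finite ebar)"
  using left_minus[of x] by (simp add: uminus_ebar_def)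

interpretation ebar: vector_space "ebar_scale :: bit \<Rightarrow> 'n::finite ebar \<Rightarrow> 'n ebar"
proof
  fix c d :: bit and x y :: "'n ebar"
  show "ebar_scale c (x + y) = ebar_scale c x + ebar_scale c y"
    by (simp add: ebar_scale_def)
  show "ebar_scale (c + d) x = ebar_scale c x + ebar_scale d x"
    by (cases c; cases d) (simp_all add: ebar_scale_def ebar_add_self)
  show "ebar_scale c (ebar_scale d x) = ebar_scale (c * d) x"
    by (cases c; cases d) (simp_all add: ebar_scale_def)
  show "ebar_scale 1 x = x"
    by (simp add: ebar_scale_def)
qed

text \<open>If \<open>g ** g\<close> is not \<open>I\<close>, then it is \<open>- I\<close>, by \<open>E_group_square\<close>.\<close>

lift_definition ebar_Q :: "'n::finite ebar \<Rightarrow> bit" is "\<lambda>g. if g ** g = mat 1 then 0 else 1"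
  by (auto simp: ebar_rel_def E_group_mult_minus)

lemma ebar_Q_XY: "ebar_Q (abs_ebar (X_op a ** Y_op b)) = bit_dot a b"
proof -
  have "ebar_rel (X_op a ** Y_op b) (X_op a ** Y_op b)"
    by (simp add: ebar_rel_def XY_in_E_group)
  moreover have "- mat 1 \<noteq> (mat 1 :: 'a bitmat)"
    by (simp add: vec_eq_iff mat_def) auto
  moreover have "bit_dot b a = bit_dot a b"
    by (simp add: bit_dot_def mult.commute)
  ultimately show ?thesis
    by (cases "bit_dot a b")
      (simp_all add: ebar_Q.abs_eq XY_mult X_op_0 Y_op_0 bit_sign_def)
qed

definition totally_singular :: "'n::finite ebar set \<Rightarrow> bool" where
  "totally_singular S \<longleftrightarrow> (\<forall>x\<in>S. ebar_Q x = 0)"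

definition ebar_preimage :: "'n::finite ebar set \<Rightarrow> 'n bitmat set" where
  "ebar_preimage S = {g \<in> E_group. abs_ebar g \<in> S}"

definition is_character :: "'n::finite bitmat set \<Rightarrow> ('n bitmat \<Rightarrow> real) \<Rightarrow> bool" where
  "is_character S c \<longleftrightarrow>
     (\<forall>g\<in>S. c g \<in> {1, - 1}) \<and> (\<forall>g\<in>S. \<forall>h\<in>S. c (g ** h) = c g * c h)"

definition eigenspace_of :: "'n::finite bitmat set \<Rightarrow> ('n bitmat \<Rightarrow> real) \<Rightarrow> (real ^ (bit ^ 'n)) set" where
  "eigenspace_of S c = {v. \<forall>g\<in>S. g *v v = c g *\<^sub>R v}"

definition invariant_subspaces :: "'n::finite bitmat set \<Rightarrow> (real ^ (bit ^ 'n)) set set" where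
  "invariant_subspaces S = {eigenspace_of S c | c. is_character S c \<and> c (- mat 1) = - 1}"

definition gaussian_binomial :: "nat \<Rightarrow> nat \<Rightarrow> real" where
  "gaussian_binomial i k = (\<Prod>j<k. (2 ^ (i - j) - 1)) / (\<Prod>j<k. (2 ^ (k - j) - 1))"

end

theory Submission
  imports Defs
begin

text \<open>
  In coordinates \<open>p = (a, b)\<close>, the matrices \<open>X(a) Y(b)\<close> multiply by a sign cocycle and are
  orthogonal for the Hilbert-Schmidt product. The orthogonal projection onto \<open>V\<^sub>\<chi>\<close> is the average
  of \<open>\<chi>(p) X(a) Y(b)\<close> over \<open>S\<close>, so the trace of the product of two such projections is
  \<open>2^i / |S|^2\<close> (with \<open>S\<close> modulo its center) times \<open>|S \<inter> T|\<close> or \<open>0\<close>, according to whether the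
  characters agree on \<open>S \<inter> T\<close>. For distinct pairs \<open>(S, \<chi>)\<close> it is at most \<open>2^k / 2\<close>, half of the
  dimension; this gives both distinctness of the planes and the minimal distance. Totally singular
  subspaces are counted through their ordered bases: the number of singular vectors orthogonal
  to a totally singular subspace is a character sum.
\<close>

section \<open>Groups of exponent two and their ordered bases\<close>

text \<open>The distance is defined by a greedy recursion on angles under a choice operator, whereas
  eigenspaces are accessible through traces. What connects them is that \<open>u l\<close> is
  orthogonal to \<open>v j\<close> for \<open>l \<noteq> j\<close>, for every valid choice of
  principal vectors: the cross Gram matrix is diagonal, so the squared cosines add up to the trace.

  A character \<chi> with \<chi>(-I) = -1 does not descend to the quotient by the center. Evaluated
  at the representatives X(a) Y(b), it becomes a function that is multiplicative up to the cocycle.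
  Two such functions carry the same twist, so their product on a common subgroup is an honest
  character, whose sum is all or nothing.

  Counting gives the Gaussian binomial at r = i - k, which symmetry turns into the one at k. The
  bound k <= i - 1 makes r positive, so that two distinct planes exist at all.\<close>

class char2_group = ab_group_add +
  assumes char2_add_self [simp]: "x + x = 0"
begin

lemma char2_add_cancel [simp]: "x + (x + y) = y" "x + y + y = x"
proof -
  show "x + (x + y) = y" by (metis add_assoc add_0_left char2_add_self)
  show "x + y + y = x" by (metis add_assoc add_0_right char2_add_self)
qed

lemma char2_add_eq_0_iff: "x + y = 0 \<longleftrightarrow> x = y"
  by (metis char2_add_cancel(1) char2_add_self add_0_right)

end

instance bit :: char2_group by standard simp
instance vec :: (char2_group, finite) char2_group by standard (simp add: vec_eq_iff)
instance prod :: (char2_group, char2_group) char2_group by standard (simp add: prod_eq_iff)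

text \<open>Inverses are covered because \<open>- x = x\<close>. Over the field with two elements
  these are exactly the linear subspaces.\<close>

definition subgrp :: "'a::char2_group set \<Rightarrow> bool" where
  "subgrp H \<longleftrightarrow> 0 \<in> H \<and> (\<forall>x\<in>H. \<forall>y\<in>H. x + y \<in> H)"

lemma subgrp_zero: "subgrp H \<Longrightarrow> 0 \<in> H"
  and subgrp_add: "subgrp H \<Longrightarrow> x \<in> H \<Longrightarrow> y \<in> H \<Longrightarrow> x + y \<in> H"
  by (auto simp: subgrp_def)

lemma subgrp_add_iff: "subgrp H \<Longrightarrow> y \<in> H \<Longrightarrow> x + y \<in> H \<longleftrightarrow> x \<in> H"
  by (metis subgrp_add char2_add_cancel(2))

lemma subgrp_UNIV: "subgrp UNIV"
  by (simp add: subgrp_def)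

lemma subgrp_Int: "subgrp H \<Longrightarrow> subgrp K \<Longrightarrow> subgrp (H \<inter> K)"
  by (auto simp: subgrp_def)

lemma sum_subgrp_translate:
  assumes "subgrp H" "y \<in> H"
  shows "(\<Sum>x\<in>H. f (x + y)) = (\<Sum>x\<in>H. f x)"
  by (rule sum.reindex_bij_witness[where i = "\<lambda>x. x + y" and j = "\<lambda>x. x + y"])
    (use assms in \<open>auto simp: subgrp_add\<close>)

text \<open>Translation by an element where the character is -1 negates the sum. Every trace and
  every count below rests on this dichotomy.\<close>

lemma sum_real_character:
  fixes \<psi> :: "'a::char2_group \<Rightarrow> real"
  assumes H: "subgrp H"
    and mult: "\<And>x y. x \<in> H \<Longrightarrow> y \<in> H \<Longrightarrow> \<psi> (x + y) = \<psi> x * \<psi> y"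
    and one: "\<And>x. x \<in> H \<Longrightarrow> \<psi> x = 1 \<or> \<psi> x = - 1"
  shows "(\<Sum>x\<in>H. \<psi> x) = (if \<forall>x\<in>H. \<psi> x = 1 then real (card H) else 0)"
proof (cases "\<forall>x\<in>H. \<psi> x = 1")
  case False
  then obtain y where y: "y \<in> H" "\<psi> y = - 1"
    using one by blast
  have "(\<Sum>x\<in>H. \<psi> x) = (\<Sum>x\<in>H. \<psi> (x + y))"
    using sum_subgrp_translate[OF H y(1), of \<psi>] by simp
  also have "\<dots> = (\<Sum>x\<in>H. - \<psi> x)"
    by (rule sum.cong) (simp_all add: mult y)
  finally have "(\<Sum>x\<in>H. \<psi> x) = 0"
    by (simp add: sum_negf)
  with False show ?thesis
    by auto
qed simp

section \<open>Adjoining elements and counting ordered bases\<close>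

definition adjoin :: "'a::char2_group \<Rightarrow> 'a set \<Rightarrow> 'a set" where
  "adjoin x H = H \<union> (+) x ` H"

lemma mem_adjoin_iff: "z \<in> adjoin x H \<longleftrightarrow> z \<in> H \<or> x + z \<in> H"
  unfolding adjoin_def by (auto simp: image_iff) (metis char2_add_cancel(1))

lemma subgrp_adjoin:
  assumes "subgrp H"
  shows "subgrp (adjoin x H)"
  unfolding subgrp_def
proof (intro conjI ballI)
  show "0 \<in> adjoin x H"
    using assms by (simp add: mem_adjoin_iff subgrp_zero)
  fix y z assume yz: "y \<in> adjoin x H" "z \<in> adjoin x H"
  have "x + y + (x + z) = y + z"
    by (metis add.assoc add.left_commute char2_add_cancel(1))
  with yz show "y + z \<in> adjoin x H"
    unfolding mem_adjoin_iff
    using subgrp_add[OF assms, of y z] subgrp_add[OF assms, of "x + y" z]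
      subgrp_add[OF assms, of y "x + z"] subgrp_add[OF assms, of "x + y" "x + z"]
    by (auto simp: ac_simps)
qed

lemma card_adjoin:
  fixes H :: "'a::{char2_group, finite} set"
  assumes "subgrp H" "x \<notin> H"
  shows "card (adjoin x H) = 2 * card H"
proof -
  have "H \<inter> (+) x ` H = {}"
    using assms by (auto simp: subgrp_add_iff)
  moreover have "card ((+) x ` H) = card H"
    by (simp add: card_image)
  ultimately show ?thesis
    unfolding adjoin_def by (subst card_Un_disjoint) auto
qed

lemma adjoin_subset_iff:
  assumes "subgrp K" "H \<subseteq> K" "0 \<in> H"
  shows "adjoin x H \<subseteq> K \<longleftrightarrow> x \<in> K"
  using assms by (auto simp: adjoin_def subgrp_add)

text \<open>A proper subgroup misses a whole coset. This is the source of the factor 1/2 in the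
  overlap bound.\<close>

lemma card_psubset_subgrp:
  fixes H K :: "'a::{char2_group, finite} set"
  assumes "subgrp H" "subgrp K" "K \<subset> H"
  shows "2 * card K \<le> card H"
proof -
  obtain x where x: "x \<in> H" "x \<notin> K"
    using assms by auto
  have "adjoin x K \<subseteq> H"
    using assms x by (subst adjoin_subset_iff) (auto simp: subgrp_zero)
  then have "card (adjoin x K) \<le> card H"
    by (rule card_mono[rotated]) simp
  then show ?thesis
    using card_adjoin[OF assms(2) x(2)] by simp
qed

fun gen :: "'a::char2_group list \<Rightarrow> 'a set" where
  "gen [] = {0}"
| "gen (x # xs) = adjoin x (gen xs)"

fun indep :: "'a::char2_group list \<Rightarrow> bool" where
  "indep [] \<longleftrightarrow> True"
| "indep (x # xs) \<longleftrightarrow> x \<notin> gen xs \<and> indep xs"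

lemma subgrp_gen: "subgrp (gen xs)"
  by (induction xs) (auto simp: subgrp_adjoin, simp add: subgrp_def)

lemma card_gen:
  fixes xs :: "'a::{char2_group, finite} list"
  shows "indep xs \<Longrightarrow> card (gen xs) = 2 ^ length xs"
  by (induction xs) (auto simp: card_adjoin subgrp_gen)

text \<open>A good list is a head placed on a good tail, since \<open>P\<close> passes to smaller
  sets. The number of heads depends only on the size of the group generated by the tail, so the
  counts multiply.\<close>

lemma card_indep_lists:
  fixes P :: "'a::{char2_group, finite} set \<Rightarrow> bool" and c :: "nat \<Rightarrow> nat"
  assumes P0: "P {0}"
    and mono: "\<And>H K. P K \<Longrightarrow> H \<subseteq> K \<Longrightarrow> P H"
    and step: "\<And>H j. subgrp H \<Longrightarrow> P H \<Longrightarrow> card H = 2 ^ j \<Longrightarrow> j < r \<Longrightarrow>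
      card {x. x \<notin> H \<and> P (adjoin x H)} = c j"
  shows "m \<le> r \<Longrightarrow> card {xs. length xs = m \<and> indep xs \<and> P (gen xs)} = (\<Prod>j<m. c j)"
proof (induction m)
  case 0
  have "{xs. length xs = 0 \<and> indep xs \<and> P (gen xs)} = {[]}"
    using P0 by auto
  then show ?case
    by simp
next
  case (Suc m)
  let ?L = "{xs. length xs = m \<and> indep xs \<and> P (gen xs)}"
  let ?X = "\<lambda>xs. {x. x \<notin> gen xs \<and> P (adjoin x (gen xs))}"
  have fin: "finite ?L"
    by (rule finite_subset[OF _ finite_lists_length_eq[of UNIV m]]) auto
  have "{xs. length xs = Suc m \<and> indep xs \<and> P (gen xs)} = (\<lambda>(xs, x). x # xs) ` (SIGMA xs:?L. ?X xs)"
    (is "?A = ?f ` ?B")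
  proof (intro set_eqI iffI)
    fix ys assume "ys \<in> ?A"
    then obtain x xs where "ys = x # xs" "length xs = m" "indep (x # xs)" "P (gen (x # xs))"
      by (auto simp: length_Suc_conv)
    then show "ys \<in> ?f ` ?B"
      using mono[of "gen ys" "gen xs"] by (auto simp: adjoin_def image_iff)
  qed auto
  moreover have "inj_on ?f ?B"
    by (auto simp: inj_on_def)
  ultimately have "card ?A = card ?B"
    by (simp add: card_image)
  also have "\<dots> = (\<Sum>xs\<in>?L. card (?X xs))"
    using fin by (subst card_SigmaI) auto
  also have "\<dots> = (\<Sum>xs\<in>?L. c m)"
    using Suc.prems by (intro sum.cong step) (auto simp: subgrp_gen card_gen)
  finally show ?case
    using Suc by (simp add: mult.commute)
qed

text \<open>Instance with \<open>P\<close> as containment in \<open>H\<close>: an independent list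
  of full length inside \<open>H\<close> generates \<open>H\<close> by cardinality.\<close>

lemma card_ordered_bases:
  fixes H :: "'a::{char2_group, finite} set"
  assumes H: "subgrp H" "card H = 2 ^ r"
  shows "card {xs. length xs = r \<and> indep xs \<and> gen xs = H} = (\<Prod>j<r. 2 ^ r - 2 ^ j)"
proof -
  have "gen xs = H" if "length xs = r" "indep xs" "gen xs \<subseteq> H" for xs
    using that card_gen[of xs] H card_subset_eq[of H "gen xs"] by auto
  then have "{xs. length xs = r \<and> indep xs \<and> gen xs = H} = {xs. length xs = r \<and> indep xs \<and> gen xs \<subseteq> H}"
    by auto
  also have "card \<dots> = (\<Prod>j<r. 2 ^ r - 2 ^ j)"
  proof (rule card_indep_lists[where r = r])
    fix K :: "'a set" and j assume K: "subgrp K" "K \<subseteq> H" "card K = 2 ^ j"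
    have "{x. x \<notin> K \<and> adjoin x K \<subseteq> H} = H - K"
      using adjoin_subset_iff[OF H(1) K(2) subgrp_zero[OF K(1)]] by auto
    then show "card {x. x \<notin> K \<and> adjoin x K \<subseteq> H} = 2 ^ r - 2 ^ j"
      using K H by (simp add: card_Diff_subset)
  qed (use H in \<open>auto simp: subgrp_zero\<close>)
  finally show ?thesis .
qed

text \<open>Existence is read off from the count, no factor of which vanishes.\<close>

lemma ordered_basis_exists:
  fixes H :: "'a::{char2_group, finite} set"
  assumes H: "subgrp H" "card H = 2 ^ r"
  obtains xs where "length xs = r" "indep xs" "gen xs = H"
proof -
  have "(\<Prod>j<r. 2 ^ r - 2 ^ j) \<noteq> (0::nat)"
    by simp
  then have "{xs. length xs = r \<and> indep xs \<and> gen xs = H} \<noteq> {}"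
    using card_ordered_bases[OF H] by force
  then show thesis
    using that by blast
qed

text \<open>Double counting: independent lists of length \<open>r\<close> are sorted by the subgroup
  they generate, and all fibres have the same size.\<close>

lemma card_subgrps:
  fixes P :: "'a::{char2_group, finite} set \<Rightarrow> bool" and c :: "nat \<Rightarrow> nat"
  assumes P0: "P {0}"
    and mono: "\<And>H K. P K \<Longrightarrow> H \<subseteq> K \<Longrightarrow> P H"
    and step: "\<And>H j. subgrp H \<Longrightarrow> P H \<Longrightarrow> card H = 2 ^ j \<Longrightarrow> j < r \<Longrightarrow>
      card {x. x \<notin> H \<and> P (adjoin x H)} = c j"
  shows "card {H. subgrp H \<and> card H = 2 ^ r \<and> P H} * (\<Prod>j<r. 2 ^ r - 2 ^ j) = (\<Prod>j<r. c j)"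
proof -
  let ?M = "{H. subgrp H \<and> card H = 2 ^ r \<and> P H}"
  let ?F = "\<lambda>H. {xs. length xs = r \<and> indep xs \<and> gen xs = H}"
  have fin: "finite (?F H)" for H :: "'a set"
    by (rule finite_subset[OF _ finite_lists_length_eq[of UNIV r]]) auto
  have "(\<Prod>j<r. c j) = card {xs. length xs = r \<and> indep xs \<and> P (gen xs)}"
    by (rule card_indep_lists[symmetric, where r = r])
      (use P0 in simp, erule mono, assumption, rule step, assumption+, simp)
  also have "{xs. length xs = r \<and> indep xs \<and> P (gen xs)} = (\<Union>H\<in>?M. ?F H)"
    by (auto simp: subgrp_gen card_gen)
  also have "card \<dots> = (\<Sum>H\<in>?M. card (?F H))"
    using fin by (intro card_UN_disjoint) auto
  also have "\<dots> = (\<Sum>H\<in>?M. \<Prod>j<r. 2 ^ r - 2 ^ j)"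
    by (intro sum.cong refl card_ordered_bases) auto
  finally show ?thesis
    by simp
qed

section \<open>Principal angles and orthogonal projections\<close>

text \<open>A characterisation rather than a construction, so that an averaging formula can be
  verified against it directly.\<close>

definition orth_proj_onto :: "'a::euclidean_space set \<Rightarrow> ('a \<Rightarrow> 'a) \<Rightarrow> bool" where
  "orth_proj_onto P p \<longleftrightarrow> (\<forall>x. p x \<in> P \<and> (\<forall>y\<in>P. p x \<bullet> y = x \<bullet> y))"

text \<open>The Hilbert-Schmidt product; for orthogonal projections it is the trace of their
  product.\<close>

definition hs :: "('a::euclidean_space \<Rightarrow> 'a) \<Rightarrow> ('a \<Rightarrow> 'a) \<Rightarrow> real" where
  "hs p q = (\<Sum>b\<in>Basis. p b \<bullet> q b)"

definition orthonormal_basis :: "'i set \<Rightarrow> ('i \<Rightarrow> 'a::euclidean_space) \<Rightarrow> 'a set \<Rightarrow> bool" where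
  "orthonormal_basis I f P \<longleftrightarrow> finite I \<and> span (f ` I) = P \<and>
     (\<forall>i\<in>I. \<forall>j\<in>I. f i \<bullet> f j = (if i = j then 1 else 0))"

text \<open>The difference of the two sides lies in \<open>P\<close> and is orthogonal to a basis of
  \<open>P\<close>, hence to itself.\<close>

lemma orth_proj_onto_expand:
  assumes p: "orth_proj_onto P p" and f: "orthonormal_basis I f P"
  shows "p x = (\<Sum>i\<in>I. (f i \<bullet> x) *\<^sub>R f i)"
proof -
  define z where "z = p x - (\<Sum>i\<in>I. (f i \<bullet> x) *\<^sub>R f i)"
  have fin: "finite I" and P: "P = span (f ` I)"
    and ort: "\<And>i j. i \<in> I \<Longrightarrow> j \<in> I \<Longrightarrow> f i \<bullet> f j = (if i = j then 1 else 0)"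
    using f by (auto simp: orthonormal_basis_def)
  have z: "z \<in> span (f ` I)"
    unfolding z_def using p P
    by (intro span_diff span_sum span_scale) (auto simp: orth_proj_onto_def intro: span_base)
  have "orthogonal z y" if y: "y \<in> f ` I" for y
  proof -
    obtain j where j: "j \<in> I" "y = f j"
      using y by auto
    then have "f j \<in> P"
      by (auto simp: P intro: span_base)
    then have "p x \<bullet> f j = x \<bullet> f j"
      using p by (auto simp: orth_proj_onto_def)
    moreover have "(\<Sum>i\<in>I. (f i \<bullet> x) *\<^sub>R f i) \<bullet> f j = (\<Sum>i\<in>I. if i = j then f i \<bullet> x else 0)"
      unfolding inner_sum_left using j by (intro sum.cong) (auto simp: ort)
    ultimately show ?thesis
      using j fin by (simp add: z_def orthogonal_def inner_diff_left inner_diff_right inner_commute)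
  qed
  then have "orthogonal z z"
    using z orthogonal_to_span by blast
  then show ?thesis
    by (simp add: z_def orthogonal_def)
qed

lemma hs_orthonormal_bases:
  assumes "orth_proj_onto P p" "orthonormal_basis I f P"
    and "orth_proj_onto Q q" "orthonormal_basis J g Q"
  shows "hs p q = (\<Sum>i\<in>I. \<Sum>j\<in>J. (f i \<bullet> g j)\<^sup>2)"
proof -
  have "hs p q = (\<Sum>b\<in>Basis. \<Sum>i\<in>I. \<Sum>j\<in>J. (f i \<bullet> g j) * ((f i \<bullet> b) * (g j \<bullet> b)))"
    unfolding hs_def orth_proj_onto_expand[OF assms(1,2)] orth_proj_onto_expand[OF assms(3,4)]
      inner_sum_left inner_sum_right
    by (intro sum.cong[OF refl], simp add: mult.commute mult.left_commute, rule sum.swap)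
  also have "\<dots> = (\<Sum>i\<in>I. \<Sum>j\<in>J. \<Sum>b\<in>Basis. (f i \<bullet> g j) * ((f i \<bullet> b) * (g j \<bullet> b)))"
    by (subst sum.swap, rule sum.cong[OF refl], subst sum.swap) simp
  also have "\<dots> = (\<Sum>i\<in>I. \<Sum>j\<in>J. (f i \<bullet> g j)\<^sup>2)"
    by (simp add: power2_eq_square euclidean_inner[of "f _" "g _"] flip: sum_distrib_left)
  finally show ?thesis .
qed

lemma orthonormal_basis_exists:
  assumes "subspace P"
  obtains B where "orthonormal_basis B (\<lambda>x. x) P" "card B = dim P"
proof -
  obtain B where B: "B \<subseteq> P" "pairwise orthogonal B" "\<And>x. x \<in> B \<Longrightarrow> norm x = 1"
    "independent B" "card B = dim P" "span B = P"
    using orthonormal_basis_subspace[OF assms] by metis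
  have "orthonormal_basis B (\<lambda>x. x) P"
    using B by (auto simp: orthonormal_basis_def pairwise_def orthogonal_def
        norm_eq_1 independent_imp_finite)
  with B(5) show thesis
    using that by blast
qed

text \<open>Allowing two maps \<open>p\<close> and \<open>q\<close> matters: if two different data
  gave the same plane, their projections would have this large trace, which is how distinctness is
  proved.\<close>

lemma hs_same:
  assumes "subspace P" "orth_proj_onto P p" "orth_proj_onto P q"
  shows "hs p q = real (dim P)"
proof -
  obtain B where B: "orthonormal_basis B (\<lambda>x. x) P" "card B = dim P"
    using orthonormal_basis_exists[OF assms(1)] by blast
  have "hs p q = (\<Sum>i\<in>B. \<Sum>j\<in>B. (i \<bullet> j)\<^sup>2)"
    by (rule hs_orthonormal_bases) (use assms B in auto)
  also have "\<dots> = (\<Sum>i\<in>B. \<Sum>j\<in>B. if i = j then 1 else 0)"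
    using B by (intro sum.cong refl) (auto simp: orthonormal_basis_def)
  also have "\<dots> = real (card B)"
    using B by (simp add: orthonormal_basis_def)
  finally show ?thesis
    by (simp add: B)
qed

lemma orthonormal_basis_of_dim:
  assumes P: "subspace P" and f: "f ` {..<dim P} \<subseteq> P"
    and ort: "\<And>i j. i < dim P \<Longrightarrow> j < dim P \<Longrightarrow> f i \<bullet> f j = (if i = j then 1 else 0)"
  shows "orthonormal_basis {..<dim P} f P"
proof -
  let ?B = "f ` {..<dim P}"
  have inj: "inj_on f {..<dim P}"
    by (rule inj_onI) (metis ort lessThan_iff zero_neq_one)
  have "pairwise orthogonal ?B"
    using ort by (auto simp: pairwise_def orthogonal_def)
  moreover have "0 \<notin> ?B"
    using ort by force
  ultimately have "independent ?B"
    by (rule pairwise_orthogonal_independent)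
  moreover have "card ?B = dim P"
    using inj by (simp add: card_image)
  ultimately have "P \<subseteq> span ?B"
    using f card_eq_dim[of ?B P] by simp
  then have "span ?B = P"
    using span_minimal[OF f P] by blast
  then show ?thesis
    using ort by (auto simp: orthonormal_basis_def)
qed

text \<open>First-order optimality: a maximiser of \<open>x \<bullet> y\<close> on the unit sphere of \<open>R\<close> is
  proportional to the projection of \<open>x\<close>.\<close>

lemma orthogonal_of_maximiser:
  assumes R: "subspace R" and v: "v \<in> R" "norm v = 1"
    and max: "\<And>y. y \<in> R \<Longrightarrow> norm y = 1 \<Longrightarrow> x \<bullet> y \<le> x \<bullet> v"
    and y: "y \<in> R" "v \<bullet> y = 0"
  shows "x \<bullet> y = 0"
proof (rule ccontr)
  assume nz: "x \<bullet> y \<noteq> 0"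
  then have y0: "y \<noteq> 0"
    by auto
  define e where "e = (1 / norm y) *\<^sub>R y"
  define s c where "s = x \<bullet> v" and "c = x \<bullet> e"
  \<comment> \<open>Up to scaling, \<open>z\<close> is the best competitor in the plane of
    \<open>v\<close> and \<open>e\<close>, namely the projection of \<open>x\<close>; normalised it
    attains the square root of \<open>s\<^sup>2 + c\<^sup>2\<close>, which exceeds \<open>s\<close>
    unless \<open>c = 0\<close>.\<close>
  define z where "z = s *\<^sub>R v + c *\<^sub>R e"
  have e: "e \<in> R" "norm e = 1" "v \<bullet> e = 0" "e \<bullet> e = 1" "e \<bullet> v = 0"
    using R y y0 by (auto simp: e_def subspace_scale inner_commute power2_norm_eq_inner
        simp flip: power2_eq_square)
  have c: "c \<noteq> 0"
    using nz y0 by (simp add: c_def e_def)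
  have zz: "z \<bullet> z = s\<^sup>2 + c\<^sup>2"
    using e v by (simp add: z_def inner_add inner_commute power2_eq_square norm_eq_1)
  have xz: "x \<bullet> z = s\<^sup>2 + c\<^sup>2"
    by (simp add: z_def inner_add s_def c_def power2_eq_square)
  have pos: "s\<^sup>2 + c\<^sup>2 > 0"
    using c by (simp add: add_nonneg_pos)
  then have z0: "norm z > 0"
    using zz by auto
  have zR: "z \<in> R"
    using R v e by (simp add: z_def subspace_add subspace_scale)
  have "x \<bullet> ((1 / norm z) *\<^sub>R z) \<le> s"
    unfolding s_def using z0 zR R by (intro max) (auto simp: subspace_scale)
  then have le: "s\<^sup>2 + c\<^sup>2 \<le> s * norm z"
    using z0 by (simp add: xz field_simps)
  then have "(s\<^sup>2 + c\<^sup>2)\<^sup>2 \<le> (s * norm z)\<^sup>2"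
    using pos by (intro power_mono) auto
  also have "\<dots> = s\<^sup>2 * (s\<^sup>2 + c\<^sup>2)"
    by (simp add: power_mult_distrib power2_norm_eq_inner zz)
  finally have "(s\<^sup>2 + c\<^sup>2) * c\<^sup>2 \<le> 0"
    by (simp add: power2_eq_square algebra_simps)
  then show False
    using pos c by (simp add: mult_le_0_iff)
qed

section \<open>Principal vectors: existence and mutual orthogonality\<close>

definition unit_orth :: "'a::euclidean_space set \<Rightarrow> (nat \<Rightarrow> 'a) \<Rightarrow> nat \<Rightarrow> 'a set" where
  "unit_orth P u j = {x \<in> P. norm x = 1 \<and> (\<forall>l<j. u l \<bullet> x = 0)}"

text \<open>Angles are replaced by inner products, which \<open>arccos\<close> reverses in order,
  and the recursion is cut off after \<open>m\<close> steps so that existence can be proved by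
  induction.\<close>

definition principal_vectors ::
  "'a::euclidean_space set \<Rightarrow> 'a set \<Rightarrow> nat \<Rightarrow> (nat \<Rightarrow> 'a) \<Rightarrow> (nat \<Rightarrow> 'a) \<Rightarrow> bool" where
  "principal_vectors P Q m u v \<longleftrightarrow>
     (\<forall>j<m. u j \<in> unit_orth P u j \<and> v j \<in> unit_orth Q v j \<and>
        (\<forall>x\<in>unit_orth P u j. \<forall>y\<in>unit_orth Q v j. x \<bullet> y \<le> u j \<bullet> v j))"

lemma abs_inner_unit_le: "norm x = 1 \<Longrightarrow> norm y = 1 \<Longrightarrow> \<bar>x \<bullet> y\<bar> \<le> 1"
  using Cauchy_Schwarz_ineq2[of x y] by simp

lemma principal_angles_iff:
  "principal_angles P Q \<theta> \<longleftrightarrow>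
     (\<exists>u v. principal_vectors P Q (dim P) u v \<and> (\<forall>j<dim P. \<theta> j = arccos (u j \<bullet> v j)))"
proof -
  have "arccos (u j \<bullet> v j) \<le> arccos (x \<bullet> y) \<longleftrightarrow> x \<bullet> y \<le> u j \<bullet> v j"
    if "u j \<in> unit_orth P u j" "v j \<in> unit_orth Q v j" "x \<in> unit_orth P u j" "y \<in> unit_orth Q v j"
    for u v j x y
    using that by (intro arccos_le_mono) (auto simp: unit_orth_def abs_inner_unit_le)
  then show ?thesis
    unfolding principal_angles_def principal_vectors_def Let_def unit_orth_def[symmetric]
    by (intro iff_exI) (metis (full_types))
qed

lemma subspace_unit_orth: "subspace P \<Longrightarrow> subspace {x \<in> P. \<forall>l<j. u l \<bullet> x = 0}"
  by (auto simp: subspace_def inner_add_right)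

lemma compact_unit_orth:
  assumes "subspace P"
  shows "compact (unit_orth P u j)"
proof -
  have "unit_orth P u j = sphere 0 1 \<inter> {x \<in> P. \<forall>l<j. u l \<bullet> x = 0}"
    by (auto simp: unit_orth_def)
  then show ?thesis
    using compact_Int_closed[OF compact_sphere closed_subspace[OF subspace_unit_orth[OF assms]]]
    by simp
qed

text \<open>Fewer than \<open>dim P\<close> vectors cannot span \<open>P\<close>, so a direction
  orthogonal to all of them remains.\<close>

lemma unit_orth_nonempty:
  assumes P: "subspace P" and u: "u ` {..<j} \<subseteq> P" and j: "j < dim P"
  shows "unit_orth P u j \<noteq> {}"
proof -
  have "dim (span (u ` {..<j})) \<le> j"
    by (metis card_image_le card_lessThan dim_le_card' dim_span finite_imageI finite_lessThan
        le_trans)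
  then have "span (u ` {..<j}) \<noteq> span P"
    using j by (metis dim_span not_le)
  then have "span (u ` {..<j}) \<subset> span P"
    using u span_mono[of "u ` {..<j}" P] by auto
  then obtain x where x: "x \<noteq> 0" "x \<in> span P" "\<And>y. y \<in> span (u ` {..<j}) \<Longrightarrow> orthogonal x y"
    by (rule orthogonal_to_subspace_exists_gen) (rule that)
  have xP: "x \<in> P"
    using x(2) P by (simp add: span_eq_iff[THEN iffD2])
  have ux: "u l \<bullet> x = 0" if "l < j" for l
  proof -
    have "u l \<in> span (u ` {..<j})"
      using that by (intro span_base) auto
    then have "orthogonal x (u l)"
      by (rule x(3))
    then show ?thesis
      by (simp add: orthogonal_def inner_commute)
  qed
  have "(1 / norm x) *\<^sub>R x \<in> unit_orth P u j"
    using x xP P by (simp add: unit_orth_def subspace_scale ux)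
  then show ?thesis
    by blast
qed

lemma unit_orth_cong: "(\<And>l. l < j \<Longrightarrow> u l = u' l) \<Longrightarrow> unit_orth P u j = unit_orth P u' j"
  by (auto simp: unit_orth_def)

text \<open>Each greedy step maximises a continuous function on a nonempty compact set.\<close>

lemma principal_vectors_exist:
  assumes P: "subspace P" and Q: "subspace Q" and m: "m \<le> dim P" "m \<le> dim Q"
  shows "\<exists>u v. principal_vectors P Q m u v"
  using m
proof (induction m)
  case 0
  show ?case
    by (simp add: principal_vectors_def)
next
  case (Suc m)
  then obtain u v where uv: "principal_vectors P Q m u v"
    by auto
  have "u ` {..<m} \<subseteq> P" "v ` {..<m} \<subseteq> Q"
    using uv by (auto simp: principal_vectors_def unit_orth_def)
  then have "unit_orth P u m \<noteq> {}" "unit_orth Q v m \<noteq> {}"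
    using Suc.prems unit_orth_nonempty[OF P] unit_orth_nonempty[OF Q] by auto
  then have "\<exists>z\<in>unit_orth P u m \<times> unit_orth Q v m. \<forall>w\<in>unit_orth P u m \<times> unit_orth Q v m.
      fst w \<bullet> snd w \<le> fst z \<bullet> snd z"
    by (intro continuous_attains_sup compact_Times compact_unit_orth P Q continuous_intros) auto
  then obtain x y where xy: "x \<in> unit_orth P u m" "y \<in> unit_orth Q v m"
    "\<And>x' y'. x' \<in> unit_orth P u m \<Longrightarrow> y' \<in> unit_orth Q v m \<Longrightarrow> x' \<bullet> y' \<le> x \<bullet> y"
    by auto
  \<comment> \<open>The feasible sets up to index \<open>m\<close> depend only on entries below
    \<open>m\<close>, so the update does not disturb them.\<close>
  have *: "unit_orth P (u(m := x)) j = unit_orth P u j" "unit_orth Q (v(m := y)) j = unit_orth Q v j"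
    if "j < Suc m" for j
    using that by (auto intro!: unit_orth_cong)
  have "principal_vectors P Q (Suc m) (u(m := x)) (v(m := y))"
    unfolding principal_vectors_def using uv xy
    by (auto simp: * less_Suc_eq principal_vectors_def)
  then show ?case
    by blast
qed

text \<open>Among the vectors of \<open>Q\<close> available at stage \<open>l\<close>,
  \<open>v l\<close> maximises the inner product with \<open>u l\<close>; \<open>v j\<close> is
  available there and orthogonal to \<open>v l\<close>, so first-order optimality applies. The other
  claim exchanges the roles.\<close>

lemma principal_vectors_orthogonal:
  assumes P: "subspace P" and Q: "subspace Q" and uv: "principal_vectors P Q m u v"
    and lj: "l < j" "j < m"
  shows "u l \<bullet> v j = 0" "v l \<bullet> u j = 0"
proof -
  have l: "u l \<in> unit_orth P u l" "v l \<in> unit_orth Q v l"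
    "\<And>x y. x \<in> unit_orth P u l \<Longrightarrow> y \<in> unit_orth Q v l \<Longrightarrow> x \<bullet> y \<le> u l \<bullet> v l"
    and j: "u j \<in> unit_orth P u j" "v j \<in> unit_orth Q v j"
    using uv lj by (auto simp: principal_vectors_def)
  show "u l \<bullet> v j = 0"
    by (rule orthogonal_of_maximiser[OF subspace_unit_orth[OF Q, of l v], where v = "v l"])
      (use l j lj in \<open>auto simp: unit_orth_def\<close>)
  show "v l \<bullet> u j = 0"
    by (rule orthogonal_of_maximiser[OF subspace_unit_orth[OF P, of l u], where v = "u l"])
      (use l j lj in \<open>auto simp: unit_orth_def inner_commute[of "v l"]\<close>)
qed

text \<open>In the bases of principal vectors the cross Gram matrix is diagonal with the cosines as
  entries. The result holds for every admissible \<theta>, which disposes of the choice operator in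
  the distance.\<close>

lemma sum_sin_principal_angles:
  assumes P: "subspace P" and Q: "subspace Q" and dim: "dim P = n" "dim Q = n"
    and p: "orth_proj_onto P p" and q: "orth_proj_onto Q q"
    and \<theta>: "principal_angles P Q \<theta>"
  shows "(\<Sum>j<n. (sin (\<theta> j))\<^sup>2) = real n - hs p q"
proof -
  obtain u v where uv: "principal_vectors P Q n u v"
    and \<theta>: "\<And>j. j < n \<Longrightarrow> \<theta> j = arccos (u j \<bullet> v j)"
    using \<theta> by (auto simp: principal_angles_iff dim)
  have mem: "u j \<in> unit_orth P u j" "v j \<in> unit_orth Q v j" if "j < n" for j
    using uv that by (auto simp: principal_vectors_def)
  have ort: "orthonormal_basis {..<n} f R"
    if R: "subspace R" "dim R = n" and f: "\<And>j. j < n \<Longrightarrow> f j \<in> unit_orth R f j" for f R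
  proof -
    have "f i \<bullet> f j = 0" if "i < j" "j < n" for i j
      using f[OF that(2)] that by (simp add: unit_orth_def)
    moreover have "f i \<bullet> f i = 1" if "i < n" for i
      using f[OF that] by (simp add: unit_orth_def norm_eq_1)
    ultimately have "f i \<bullet> f j = (if i = j then 1 else 0)" if "i < n" "j < n" for i j
      using that by (metis inner_commute linorder_neqE_nat)
    moreover have "f ` {..<n} \<subseteq> R"
      using f by (auto simp: unit_orth_def)
    ultimately show ?thesis
      using orthonormal_basis_of_dim[OF R(1), of f] R(2) by simp
  qed
  have u: "orthonormal_basis {..<n} u P"
    by (rule ort[OF P dim(1) mem(1)])
  have v: "orthonormal_basis {..<n} v Q"
    by (rule ort[OF Q dim(2) mem(2)])
  have cross: "u i \<bullet> v j = 0" if "i < n" "j < n" "i \<noteq> j" for i j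
    using principal_vectors_orthogonal[OF P Q uv] that
    by (metis inner_commute linorder_neqE_nat)
  have "hs p q = (\<Sum>i<n. \<Sum>j<n. (u i \<bullet> v j)\<^sup>2)"
    by (rule hs_orthonormal_bases[OF p u q v])
  also have "\<dots> = (\<Sum>i<n. \<Sum>j<n. if j = i then (u i \<bullet> v i)\<^sup>2 else 0)"
    by (intro sum.cong refl) (auto simp: cross)
  also have "\<dots> = (\<Sum>i<n. (u i \<bullet> v i)\<^sup>2)"
    by simp
  finally have hs: "hs p q = (\<Sum>i<n. (u i \<bullet> v i)\<^sup>2)" .
  have "(sin (\<theta> j))\<^sup>2 = 1 - (u j \<bullet> v j)\<^sup>2" if "j < n" for j
  proof -
    have "\<bar>u j \<bullet> v j\<bar> \<le> 1"
      using mem[OF that] by (auto simp: unit_orth_def abs_inner_unit_le)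
    then show ?thesis
      using that by (simp add: \<theta> sin_squared_eq cos_arccos_abs)
  qed
  then show ?thesis
    by (simp add: hs sum_subtractf)
qed

theorem grass_dist_eq:
  assumes P: "subspace P" and Q: "subspace Q" and dim: "dim P = n" "dim Q = n"
    and p: "orth_proj_onto P p" and q: "orth_proj_onto Q q"
  shows "grass_dist P Q = sqrt (real n - hs p q)"
proof -
  obtain u v where "principal_vectors P Q n u v"
    using principal_vectors_exist[OF P Q, of n] dim by auto
  then have "principal_angles P Q (\<lambda>j. arccos (u j \<bullet> v j))"
    by (auto simp: principal_angles_iff dim)
  then have "principal_angles P Q (SOME \<theta>. principal_angles P Q \<theta>)"
    by (intro someI_ex[of "principal_angles P Q"]) blast
  from sum_sin_principal_angles[OF P Q dim p q this] show ?thesis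
    by (simp add: grass_dist_def Let_def dim)
qed

section \<open>Joint eigenspaces in coordinates\<close>

type_synonym 'n pauli_pt = "(bit ^ 'n) \<times> (bit ^ 'n)"

text \<open>One representative in \<open>E_group\<close> for each class modulo sign.\<close>

definition pauli :: "('n::finite) pauli_pt \<Rightarrow> 'n bitmat" where
  "pauli p = X_op (fst p) ** Y_op (snd p)"

text \<open>The cocycle of the extension \<open>E\<close>. On the diagonal it is \<open>(- 1) ^ Q\<close>, and its
  antisymmetrisation \<open>sigma p q * sigma q p\<close> is the commutator pairing.\<close>

definition sigma :: "('n::finite) pauli_pt \<Rightarrow> 'n pauli_pt \<Rightarrow> real" where
  "sigma p q = bit_sign (bit_dot (snd p) (fst q))"

lemma bit_dot_commute: "bit_dot a b = bit_dot b a"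
  by (simp add: bit_dot_def mult.commute)

lemma bit_dot_zero [simp]: "bit_dot 0 b = 0" "bit_dot a 0 = 0"
  by (simp_all add: bit_dot_def)

lemma bit_dot_axis: "bit_dot a (axis j 1) = a $ j"
proof -
  have "bit_dot a (axis j 1) = (\<Sum>l\<in>UNIV. if l = j then a $ l else 0)"
    unfolding bit_dot_def by (rule sum.cong) (auto simp: axis_def)
  then show ?thesis
    by simp
qed

lemma bit_sign_eq_1_iff: "bit_sign c = 1 \<longleftrightarrow> c = 0"
  by (simp add: bit_sign_def)

lemma bit_sign_0 [simp]: "bit_sign 0 = 1"
  by (simp add: bit_sign_def)

lemma bit_dot_nondegenerate: "(\<forall>u. bit_dot b u = 0) \<longleftrightarrow> b = 0"
proof
  assume "\<forall>u. bit_dot b u = 0"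
  then have "b $ j = 0" for j
    using bit_dot_axis[of b j] by simp
  then show "b = 0"
    by (simp add: vec_eq_iff)
qed simp

lemma sum_bit_sign_dot:
  "(\<Sum>u\<in>UNIV. bit_sign (bit_dot b u)) = (if b = 0 then 2 ^ CARD('n) else 0)"
  for b :: "bit ^ 'n::finite"
  using sum_real_character[OF subgrp_UNIV, of "\<lambda>u. bit_sign (bit_dot b u)"] bit_sign_cases
  by (simp add: bit_dot_add_right bit_sign_add bit_sign_eq_1_iff bit_dot_nondegenerate CARD_bit)

lemma sigma_cases: "sigma p q = 1 \<or> sigma p q = - 1"
  by (simp add: sigma_def bit_sign_cases)

lemma sigma_square [simp]: "sigma p q * sigma p q = 1" "sigma p q * (sigma p q * x) = x"
  using sigma_cases[of p q] by auto

lemma sigma_add: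
  "sigma (p + p') q = sigma p q * sigma p' q" "sigma p (q + q') = sigma p q * sigma p q'"
  by (simp_all add: sigma_def bit_dot_add_left bit_dot_add_right bit_sign_add)

lemma sigma_zero [simp]: "sigma 0 q = 1" "sigma p 0 = 1"
  by (simp_all add: sigma_def)

lemma pauli_mult: "pauli p ** pauli q = sigma p q *\<^sub>R pauli (p + q)"
  by (simp add: pauli_def sigma_def XY_mult)

lemma pauli_mult_vec: "pauli p *v (pauli q *v x) = sigma p q *\<^sub>R (pauli (p + q) *v x)"
  by (simp add: matrix_vector_mul_assoc pauli_mult scaleR_matrix_vector_assoc)

lemma pauli_axis:
  "pauli p *v axis u 1 = bit_sign (bit_dot (snd p) u) *\<^sub>R axis (u + fst p) 1"
  by (simp add: pauli_def XY_axis)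

lemma pauli_zero: "pauli 0 = mat 1"
  by (simp add: pauli_def X_op_0 Y_op_0)

lemma pauli_component: "pauli p $ w $ u = (if w = u + fst p then bit_sign (bit_dot (snd p) u) else 0)"
proof -
  have "pauli p $ w $ u = (pauli p *v axis u 1) $ w"
    by (simp add: matrix_vector_mult_basis column_def)
  then show ?thesis
    by (simp only: pauli_axis) (simp add: axis_def)
qed

text \<open>The matrix is orthogonal and its square is \<open>sigma p p\<close> times the identity,
  so its inverse is itself up to that sign. Singular elements thus act by symmetric
  matrices.\<close>

lemma transpose_pauli: "transpose (pauli p) = sigma p p *\<^sub>R pauli p"
proof -
  have eq: "w = u + a \<longleftrightarrow> u = w + a" for w u a :: "bit ^ 'n"
    by auto
  have "transpose (pauli p) $ w $ u = (sigma p p *\<^sub>R pauli p) $ w $ u" for w u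
    by (cases "w = u + fst p")
      (simp_all add: transpose_def pauli_component eq[of u w] sigma_def bit_dot_add_right
        bit_sign_add mult.commute)
  then show ?thesis
    by (simp only: vec_eq_iff) simp
qed

lemma inner_pauli: "(pauli p *v x) \<bullet> y = sigma p p * (x \<bullet> (pauli p *v y))"
proof -
  have "(pauli p *v x) \<bullet> y = y \<bullet> (pauli p *v x)"
    by (rule inner_commute)
  also have "\<dots> = (transpose (pauli p) *v y) \<bullet> x"
    by (simp add: dot_lmul_matrix)
  finally show ?thesis
    by (simp add: transpose_pauli inner_commute flip: scaleR_matrix_vector_assoc)
qed

lemma sum_Basis_vec:
  fixes f :: "real ^ 'm::finite \<Rightarrow> 'a::comm_monoid_add"
  shows "(\<Sum>b\<in>Basis. f b) = (\<Sum>u\<in>UNIV. f (axis u 1))"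
  by (rule sum.reindex_bij_betw[symmetric])
    (auto simp: bij_betw_def inj_on_def axis_eq_axis Basis_vec_def)

text \<open>Different shifts send each basis vector to different basis vectors. For equal shifts a
  character sum over \<open>U\<close> remains, which vanishes unless the second coordinates
  agree.\<close>

lemma hs_pauli:
  fixes p q :: "('n::finite) pauli_pt"
  shows "hs ((*v) (pauli p)) ((*v) (pauli q)) = (if p = q then 2 ^ CARD('n) else 0)"
proof -
  have "hs ((*v) (pauli p)) ((*v) (pauli q)) =
      (\<Sum>u\<in>UNIV. if fst p = fst q then bit_sign (bit_dot (snd p + snd q) u) else 0)"
    unfolding hs_def sum_Basis_vec
    by (rule sum.cong)
      (auto simp: pauli_axis inner_axis_axis bit_dot_add_left bit_sign_add)
  also have "\<dots> = (if fst p = fst q \<and> snd p + snd q = 0 then 2 ^ CARD('n) else 0)"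
    by (cases "fst p = fst q") (simp_all add: sum_bit_sign_dot)
  finally show ?thesis
    by (simp add: char2_add_eq_0_iff prod_eq_iff)
qed

text \<open>Total singularity in coordinates, since \<open>sigma p p\<close> is the sign of the
  quadratic form at \<open>p\<close>.\<close>

definition isotropic :: "('n::finite) pauli_pt set \<Rightarrow> bool" where
  "isotropic H \<longleftrightarrow> (\<forall>p\<in>H. sigma p p = 1)"

text \<open>Polarisation: where the quadratic form vanishes on \<open>p\<close>, \<open>q\<close>
  and \<open>p + q\<close>, the commutator pairing vanishes too.\<close>

lemma sigma_commute:
  assumes "isotropic H" "subgrp H" "p \<in> H" "q \<in> H"
  shows "sigma p q = sigma q p"
proof -
  have "sigma (p + q) (p + q) = 1" "sigma p p = 1" "sigma q q = 1"
    using assms by (auto simp: isotropic_def subgrp_add)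
  then have "sigma p q * sigma q p = 1"
    by (simp add: sigma_add mult.commute)
  then show ?thesis
    using sigma_cases[of p q] sigma_cases[of q p] by auto
qed

text \<open>The values at \<open>pauli p\<close> of a character of the preimage that sends -I to -1;
  the cocycle records the sign lost in passing to representatives.\<close>

definition twisted_char :: "('n::finite) pauli_pt set \<Rightarrow> ('n pauli_pt \<Rightarrow> real) \<Rightarrow> bool" where
  "twisted_char H f \<longleftrightarrow> (\<forall>p\<in>H. f p = 1 \<or> f p = - 1) \<and>
     (\<forall>p\<in>H. \<forall>q\<in>H. f (p + q) = sigma p q * f p * f q)"

lemma twisted_char_cases: "twisted_char H f \<Longrightarrow> p \<in> H \<Longrightarrow> f p = 1 \<or> f p = - 1"
  and twisted_char_add:
    "twisted_char H f \<Longrightarrow> p \<in> H \<Longrightarrow> q \<in> H \<Longrightarrow> f (p + q) = sigma p q * f p * f q"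
  by (auto simp: twisted_char_def)

lemma twisted_char_square: "twisted_char H f \<Longrightarrow> p \<in> H \<Longrightarrow> f p * f p = 1"
  using twisted_char_cases by fastforce

definition joint_eigenspace ::
  "('n::finite) pauli_pt set \<Rightarrow> ('n pauli_pt \<Rightarrow> real) \<Rightarrow> (real ^ (bit ^ 'n)) set" where
  "joint_eigenspace H f = {v. \<forall>p\<in>H. pauli p *v v = f p *\<^sub>R v}"

definition eigenprojection :: "('n::finite) pauli_pt set \<Rightarrow> ('n pauli_pt \<Rightarrow> real) \<Rightarrow>
    real ^ (bit ^ 'n) \<Rightarrow> real ^ (bit ^ 'n)" where
  "eigenprojection H f x = (1 / real (card H)) *\<^sub>R (\<Sum>p\<in>H. f p *\<^sub>R (pauli p *v x))"

lemma subspace_joint_eigenspace: "subspace (joint_eigenspace H f)"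
  by (auto simp: subspace_def joint_eigenspace_def matrix_vector_right_distrib
      matrix_vector_mult_scaleR scaleR_add_right)

text \<open>Applying \<open>pauli q\<close> translates the index of the average and releases the
  factor \<open>f q\<close>. Symmetry of the matrices moves them onto \<open>y\<close>, where
  \<open>f p * f p = 1\<close> cancels.\<close>

lemma orth_proj_onto_eigenprojection:
  assumes H: "subgrp H" "isotropic H" "twisted_char H f"
  shows "orth_proj_onto (joint_eigenspace H f) (eigenprojection H f)"
  unfolding orth_proj_onto_def
proof (intro allI conjI ballI)
  fix x
  have "pauli q *v eigenprojection H f x = f q *\<^sub>R eigenprojection H f x" if q: "q \<in> H" for q
  proof -
    have "f p *\<^sub>R (pauli q *v (pauli p *v x)) = f q *\<^sub>R f (p + q) *\<^sub>R (pauli (p + q) *v x)"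
      if p: "p \<in> H" for p
      using twisted_char_add[OF H(3) p q] twisted_char_square[OF H(3) q]
        sigma_commute[OF H(2,1) p q]
      by (simp add: pauli_mult_vec add.commute ac_simps)
    then have "pauli q *v (\<Sum>p\<in>H. f p *\<^sub>R (pauli p *v x)) =
        f q *\<^sub>R (\<Sum>p\<in>H. f (p + q) *\<^sub>R (pauli (p + q) *v x))"
      by (simp add: vec.sum matrix_vector_mult_scaleR scaleR_sum_right)
    also have "\<dots> = f q *\<^sub>R (\<Sum>p\<in>H. f p *\<^sub>R (pauli p *v x))"
      using sum_subgrp_translate[OF H(1) q, of "\<lambda>p. f p *\<^sub>R (pauli p *v x)"] by simp
    finally show ?thesis
      by (simp add: eigenprojection_def matrix_vector_mult_scaleR)
  qed
  then show "eigenprojection H f x \<in> joint_eigenspace H f"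
    by (simp add: joint_eigenspace_def)
next
  fix x y assume y: "y \<in> joint_eigenspace H f"
  have "(f p *\<^sub>R (pauli p *v x)) \<bullet> y = x \<bullet> y" if "p \<in> H" for p
    using that y H twisted_char_square[OF H(3) that]
    by (simp add: inner_pauli isotropic_def joint_eigenspace_def flip: mult.assoc)
  moreover have "card H \<noteq> 0"
    using subgrp_zero[OF H(1)] by (auto simp: card_eq_0_iff)
  ultimately show "eigenprojection H f x \<bullet> y = x \<bullet> y"
    by (simp add: eigenprojection_def inner_sum_left)
qed

lemma hs_eigenprojection_sum:
  fixes H K :: "('n::finite) pauli_pt set"
  shows "hs (eigenprojection H f) (eigenprojection K g) =
    2 ^ CARD('n) / (real (card H) * real (card K)) * (\<Sum>p\<in>H \<inter> K. f p * g p)"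
proof -
  have "hs (eigenprojection H f) (eigenprojection K g) =
      (\<Sum>b\<in>Basis. \<Sum>p\<in>H. \<Sum>q\<in>K. (f p * g q / (real (card H) * real (card K))) *
         ((pauli p *v b) \<bullet> (pauli q *v b)))"
    unfolding hs_def eigenprojection_def inner_scaleR_left inner_scaleR_right inner_sum_left
      inner_sum_right sum_distrib_left
    by (intro sum.cong[OF refl], rule trans[OF _ sum.swap], simp add: ac_simps)
  also have "\<dots> = (\<Sum>p\<in>H. \<Sum>q\<in>K. (f p * g q / (real (card H) * real (card K))) *
         hs ((*v) (pauli p)) ((*v) (pauli q)))"
    unfolding hs_def sum_distrib_left
    by (subst sum.swap, rule sum.cong[OF refl], subst sum.swap) simp
  also have "\<dots> = (\<Sum>p\<in>H. \<Sum>q\<in>K. if q = p then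
      f p * g p / (real (card H) * real (card K)) * 2 ^ CARD('n) else 0)"
    by (intro sum.cong refl) (auto simp: hs_pauli)
  also have "\<dots> = (\<Sum>p\<in>H. if p \<in> K then
      f p * g p / (real (card H) * real (card K)) * 2 ^ CARD('n) else 0)"
    by simp
  also have "\<dots> = (\<Sum>p\<in>H \<inter> K. f p * g p / (real (card H) * real (card K)) * 2 ^ CARD('n))"
    by (simp only: sum.inter_restrict[OF finite])
  finally show ?thesis
    by (simp add: sum_distrib_left sum_divide_distrib mult.commute)
qed

text \<open>On \<open>H \<inter> K\<close> the twists of \<open>f\<close> and \<open>g\<close> are
  the same sign and cancel in the product, leaving an ordinary character.\<close>

lemma hs_eigenprojection:
  fixes H K :: "('n::finite) pauli_pt set"
  assumes "subgrp H" "twisted_char H f" "subgrp K" "twisted_char K g"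
  shows "hs (eigenprojection H f) (eigenprojection K g) =
    2 ^ CARD('n) / (real (card H) * real (card K)) *
      (if \<forall>p\<in>H \<inter> K. f p = g p then real (card (H \<inter> K)) else 0)"
proof -
  have cases: "f p = 1 \<or> f p = - 1" "g p = 1 \<or> g p = - 1" if "p \<in> H \<inter> K" for p
    using assms that by (auto dest: twisted_char_cases)
  then have "f p * g p = 1 \<longleftrightarrow> f p = g p" if "p \<in> H \<inter> K" for p
    using that by fastforce
  moreover have "(\<Sum>p\<in>H \<inter> K. f p * g p) =
      (if \<forall>p\<in>H \<inter> K. f p * g p = 1 then real (card (H \<inter> K)) else 0)"
  proof (rule sum_real_character)
    show "f (p + q) * g (p + q) = f p * g p * (f q * g q)" if "p \<in> H \<inter> K" "q \<in> H \<inter> K" for p q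
      using that assms by (simp add: twisted_char_add ac_simps)
    show "f p * g p = 1 \<or> f p * g p = - 1" if "p \<in> H \<inter> K" for p
      using cases[OF that] by auto
  qed (use assms in \<open>simp add: subgrp_Int\<close>)
  ultimately show ?thesis
    by (simp add: hs_eigenprojection_sum)
qed

text \<open>The dimension is the trace of the projection paired with itself. In particular no
  eigenspace is zero, which recovers characters from eigenspaces later.\<close>

lemma dim_joint_eigenspace:
  fixes H :: "('n::finite) pauli_pt set"
  assumes "subgrp H" "isotropic H" "twisted_char H f"
  shows "real (dim (joint_eigenspace H f)) * real (card H) = 2 ^ CARD('n)"
proof -
  have "real (dim (joint_eigenspace H f)) = hs (eigenprojection H f) (eigenprojection H f)"
    using assms
    by (intro hs_same[symmetric] subspace_joint_eigenspace orth_proj_onto_eigenprojection)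
  also have "\<dots> = 2 ^ CARD('n) / real (card H)"
    using assms by (simp add: hs_eigenprojection)
  finally show ?thesis
    using subgrp_zero[OF assms(1)] by (auto simp: card_eq_0_iff)
qed

text \<open>Twisted characters are normalised to \<open>1\<close> outside of \<open>H\<close>, so that they can be counted.\<close>

definition twisted_chars :: "('n::finite) pauli_pt set \<Rightarrow> ('n pauli_pt \<Rightarrow> real) set" where
  "twisted_chars H = {f. twisted_char H f \<and> (\<forall>p. p \<notin> H \<longrightarrow> f p = 1)}"

text \<open>The value \<open>s\<close> at \<open>x\<close> is free; the value at
  \<open>x + h\<close> is then forced by the twisted law, with \<open>h = x + p\<close> recovered
  from \<open>p\<close>.\<close>

definition extend_char ::
  "('n::finite) pauli_pt \<Rightarrow> 'n pauli_pt set \<Rightarrow> ('n pauli_pt \<Rightarrow> real) \<times> real \<Rightarrow> 'n pauli_pt \<Rightarrow> real" where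
  "extend_char x H = (\<lambda>(g, s) p.
     if p \<in> H then g p else if x + p \<in> H then s * sigma x (x + p) * g (x + p) else 1)"

lemma adjoin_cases:
  assumes "p \<in> adjoin x H"
  obtains "p \<in> H" | h where "h \<in> H" "p = x + h"
  using assms by (auto simp: adjoin_def)

text \<open>Isotropy of the larger group enters twice: moving \<open>x\<close> past \<open>h\<close>
  needs the cocycle to be symmetric, and two factors \<open>x\<close> cancel because
  \<open>sigma x x = 1\<close> and \<open>s * s = 1\<close>.\<close>

lemma twisted_char_extend_char:
  assumes H: "subgrp H" "x \<notin> H" "isotropic (adjoin x H)" and g: "twisted_char H g"
    and s: "s = 1 \<or> s = - 1"
  shows "twisted_char (adjoin x H) (extend_char x H (g, s))"
proof -
  let ?F = "extend_char x H (g, s)"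
  have F: "?F h = g h" "?F (x + h) = s * sigma x h * g h" if "h \<in> H" for h
    using that H by (simp_all add: extend_char_def subgrp_add_iff)
  have sg: "sigma h x = sigma x h" "sigma x x = 1" if "h \<in> H" for h
    using that H sigma_commute[OF H(3) subgrp_adjoin[OF H(1)], of h x]
    by (auto simp: adjoin_def isotropic_def image_iff subgrp_zero)
  have ss: "s * s = 1" "s * (s * t) = t" for t
    using s by auto
  show ?thesis
    unfolding twisted_char_def
  proof (intro conjI ballI)
    fix p assume "p \<in> adjoin x H"
    then show "?F p = 1 \<or> ?F p = - 1"
    proof (cases rule: adjoin_cases)
      case (2 h)
      then show ?thesis
        using F[of h] twisted_char_cases[OF g, of h] sigma_cases[of x h] s by auto
    qed (use F twisted_char_cases[OF g] in auto)
  next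
    fix p q assume p: "p \<in> adjoin x H" and q: "q \<in> adjoin x H"
    from p show "?F (p + q) = sigma p q * ?F p * ?F q"
    proof (cases rule: adjoin_cases)
      case p: 1
      from q show ?thesis
      proof (cases rule: adjoin_cases)
        case 1
        then show ?thesis
          using p H by (simp add: F subgrp_add twisted_char_add[OF g])
      next
        case (2 k)
        have eq: "p + (x + k) = x + (p + k)"
          by (rule add.left_commute)
        show ?thesis
          using p 2 H
          by (simp add: eq F subgrp_add twisted_char_add[OF g] sigma_add sg mult_ac)
      qed
    next
      case p: (2 h)
      from q show ?thesis
      proof (cases rule: adjoin_cases)
        case 1
        have eq: "x + h + q = x + (h + q)"
          by (rule add.assoc)
        show ?thesis
          using p 1 H by (simp add: eq F subgrp_add twisted_char_add[OF g] sigma_add mult_ac)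
      next
        case (2 k)
        have eq: "x + h + (x + k) = h + k"
          by (simp add: add.assoc add.left_commute[of h x])
        show ?thesis
          using p 2 H
          by (simp add: eq F subgrp_add twisted_char_add[OF g] sigma_add sg ss mult_ac)
      qed
    qed
  qed
qed

text \<open>A twisted character amounts to its restriction to \<open>H\<close> together with an
  arbitrary sign at \<open>x\<close>.\<close>

lemma card_twisted_chars_adjoin:
  fixes H :: "('n::finite) pauli_pt set"
  assumes H: "subgrp H" "x \<notin> H" "isotropic (adjoin x H)"
  shows "card (twisted_chars (adjoin x H)) = 2 * card (twisted_chars H)"
proof -
  let ?r = "\<lambda>f. (\<lambda>p. if p \<in> H then f p else 1, f x)"
  have H0: "0 \<in> H" and xA: "x \<in> adjoin x H" and HA: "H \<subseteq> adjoin x H"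
    using H by (auto simp: adjoin_def image_iff subgrp_zero)
  have g0: "g 0 = 1" if "twisted_char H g" for g
    using twisted_char_add[OF that H0 H0] twisted_char_square[OF that H0] by simp
  have "bij_betw (extend_char x H) (twisted_chars H \<times> {1, - 1}) (twisted_chars (adjoin x H))"
  proof (rule bij_betw_byWitness[where f' = ?r])
    show "\<forall>z\<in>twisted_chars H \<times> {1, - 1}. ?r (extend_char x H z) = z"
      using H H0 by (auto simp: extend_char_def twisted_chars_def fun_eq_iff g0)
    show "\<forall>f\<in>twisted_chars (adjoin x H). extend_char x H (?r f) = f"
    proof (intro ballI ext)
      fix f p assume f: "f \<in> twisted_chars (adjoin x H)"
      then have tw: "twisted_char (adjoin x H) f"
        by (simp add: twisted_chars_def)
      show "extend_char x H (?r f) p = f p"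
      proof (cases "p \<in> adjoin x H")
        case True
        then show ?thesis
        proof (cases rule: adjoin_cases)
          case (2 h)
          then show ?thesis
            using H HA xA twisted_char_add[OF tw, of x h]
            by (auto simp: extend_char_def subgrp_add_iff)
        qed (simp add: extend_char_def)
      next
        case False
        then have "f p = 1"
          using f unfolding twisted_chars_def by blast
        then show ?thesis
          using False by (simp add: extend_char_def mem_adjoin_iff)
      qed
    qed
    show "extend_char x H ` (twisted_chars H \<times> {1, - 1}) \<subseteq> twisted_chars (adjoin x H)"
      using twisted_char_extend_char[OF H]
      by (auto simp: twisted_chars_def mem_adjoin_iff) (auto simp: extend_char_def)
    show "?r ` twisted_chars (adjoin x H) \<subseteq> twisted_chars H \<times> {1, - 1}"
    proof (rule image_subsetI)
      fix f assume "f \<in> twisted_chars (adjoin x H)"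
      then have tw: "twisted_char (adjoin x H) f"
        by (simp add: twisted_chars_def)
      have "twisted_char H (\<lambda>p. if p \<in> H then f p else 1)"
        unfolding twisted_char_def
        using twisted_char_cases[OF tw] HA
        by (intro conjI ballI)
          (auto simp only: if_True subgrp_add[OF H(1)] intro!: twisted_char_add[OF tw])
      then show "?r f \<in> twisted_chars H \<times> {1, - 1}"
        using twisted_char_cases[OF tw xA] by (simp add: twisted_chars_def)
    qed
  qed
  from bij_betw_same_card[OF this] show ?thesis
    by (simp add: card_cartesian_product)
qed

lemma isotropic_subset: "isotropic K \<Longrightarrow> H \<subseteq> K \<Longrightarrow> isotropic H"
  by (auto simp: isotropic_def)

lemma twisted_chars_zero: "twisted_chars {0} = {\<lambda>_. 1}"
proof (intro set_eqI iffI)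
  fix f :: "'a pauli_pt \<Rightarrow> real" assume "f \<in> twisted_chars {0}"
  then have "f p = 1" for p
    by (cases "p = 0") (auto simp only: twisted_chars_def twisted_char_def, auto)
  then show "f \<in> {\<lambda>_. 1}"
    by auto
qed (simp add: twisted_chars_def twisted_char_def)

lemma card_twisted_chars:
  fixes H :: "('n::finite) pauli_pt set"
  assumes H: "subgrp H" "isotropic H" "card H = 2 ^ r"
  shows "card (twisted_chars H) = 2 ^ r"
proof -
  have "card (twisted_chars (gen xs)) = 2 ^ length xs" if "indep xs" "isotropic (gen xs)"
    for xs :: "'n pauli_pt list"
    using that
  proof (induction xs)
    case (Cons x xs)
    have "isotropic (gen xs)"
      using Cons.prems by (auto intro: isotropic_subset simp: adjoin_def)
    then show ?case
      using Cons by (simp add: card_twisted_chars_adjoin subgrp_gen)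
  qed (simp add: twisted_chars_zero)
  moreover obtain xs where "length xs = r" "indep xs" "gen xs = H"
    using ordered_basis_exists[OF H(1,3)] by blast
  ultimately show ?thesis
    using H by blast
qed

section \<open>Counting and transfer to the quotient group\<close>

lemma card_UNIV_pauli_pt: "card (UNIV :: ('n::finite) pauli_pt set) = 2 ^ (2 * CARD('n))"
  by (simp add: card_prod CARD_bit power_add mult_2)


text \<open>The excess of singular over nonsingular vectors; its positive sign says that the form is
  of plus type. Only \<open>a = 0\<close> contributes.\<close>

lemma sum_sigma_diagonal:
  "(\<Sum>x\<in>(UNIV :: ('n::finite) pauli_pt set). sigma x x) = 2 ^ CARD('n)"
proof -
  have "(\<Sum>x\<in>(UNIV :: 'n pauli_pt set). sigma x x) =
      (\<Sum>(a, b)\<in>UNIV \<times> UNIV. bit_sign (bit_dot a (b :: bit ^ 'n)))"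
    by (rule sum.cong) (auto simp: sigma_def bit_dot_commute)
  also have "\<dots> = (\<Sum>a\<in>UNIV. \<Sum>b\<in>UNIV. bit_sign (bit_dot a (b :: bit ^ 'n)))"
    by (rule sum.cartesian_product[symmetric])
  also have "\<dots> = 2 ^ CARD('n)"
    by (simp add: sum_bit_sign_dot)
  finally show ?thesis .
qed

text \<open>Nondegeneracy of the symplectic pairing, tested on pure shifts and pure sign
  changes.\<close>

lemma commutator_trivial_iff: "(\<forall>x. sigma x h * sigma h x = 1) \<longleftrightarrow> h = 0"
proof
  assume h: "\<forall>x. sigma x h * sigma h x = 1"
  have "bit_dot (snd h) u = 0" "bit_dot (fst h) u = 0" for u
    using h[rule_format, of "(u, 0)"] h[rule_format, of "(0, u)"]
    by (simp_all add: sigma_def bit_sign_eq_1_iff bit_dot_commute[of "fst h" u])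
  then show "h = 0"
    using bit_dot_nondegenerate[of "fst h"] bit_dot_nondegenerate[of "snd h"]
    by (simp add: prod_eq_iff)
qed simp

lemma sum_commutator:
  fixes h :: "('n::finite) pauli_pt"
  shows "(\<Sum>x\<in>UNIV. sigma x h * sigma h x) = (if h = 0 then 2 ^ (2 * CARD('n)) else 0)"
proof -
  have "sigma x h * sigma h x = 1 \<or> sigma x h * sigma h x = - 1" for x
    using sigma_cases[of x h] sigma_cases[of h x] by auto
  then have *: "(\<Sum>x\<in>UNIV. sigma x h * sigma h x) =
      (if \<forall>x\<in>UNIV. sigma x h * sigma h x = 1 then real (card (UNIV :: 'n pauli_pt set)) else 0)"
    by (intro sum_real_character subgrp_UNIV) (simp_all add: sigma_add mult_ac)
  show ?thesis
    unfolding * ball_UNIV commutator_trivial_iff card_UNIV_pauli_pt by simp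
qed

definition singular_perp :: "('n::finite) pauli_pt set \<Rightarrow> 'n pauli_pt set" where
  "singular_perp H = {x. sigma x x = 1 \<and> (\<forall>h\<in>H. sigma x h * sigma h x = 1)}"

text \<open>The indicator of \<open>singular_perp H\<close> is \<open>(1 + sigma x x) / 2\<close>
  times the average over \<open>H\<close> of the commutator pairing with \<open>x\<close>.
  Exchanging the sums leaves one character sum for each \<open>h\<close>.\<close>

lemma card_singular_perp_real:
  fixes H :: "('n::finite) pauli_pt set"
  assumes H: "subgrp H" "isotropic H"
  shows "2 * real (card H) * real (card (singular_perp H)) =
    2 ^ (2 * CARD('n)) + real (card H) * 2 ^ CARD('n)"
proof -
  let ?b = "\<lambda>x h :: 'n pauli_pt. sigma x h * sigma h x"
  have b: "(\<Sum>h\<in>H. ?b x h) = (if \<forall>h\<in>H. ?b x h = 1 then real (card H) else 0)" for x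
  proof (rule sum_real_character[OF H(1)])
    show "?b x h = 1 \<or> ?b x h = - 1" for h
      using sigma_cases[of x h] sigma_cases[of h x] by auto
  qed (simp add: sigma_add mult_ac)
  have "(\<Sum>x\<in>UNIV. \<Sum>h\<in>H. ?b x h * (1 + sigma x x)) =
      (\<Sum>x\<in>UNIV. if x \<in> singular_perp H then 2 * real (card H) else 0)"
  proof (rule sum.cong[OF refl])
    fix x
    show "(\<Sum>h\<in>H. ?b x h * (1 + sigma x x)) =
        (if x \<in> singular_perp H then 2 * real (card H) else 0)"
      using sigma_cases[of x x] unfolding sum_distrib_right[symmetric] b
      by (auto simp: singular_perp_def)
  qed
  also have "\<dots> = 2 * real (card H) * real (card (singular_perp H))"
    by (simp add: sum.If_cases mult.commute)
  finally have "2 * real (card H) * real (card (singular_perp H)) =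
      (\<Sum>h\<in>H. \<Sum>x\<in>UNIV. ?b x h * (1 + sigma x x))"
    by (simp add: sum.swap[of _ H])
  also have "\<dots> = (\<Sum>h\<in>H. (if h = 0 then 2 ^ (2 * CARD('n)) else 0) + 2 ^ CARD('n))"
  proof (rule sum.cong[OF refl])
    fix h assume h: "h \<in> H"
    \<comment> \<open>As \<open>h\<close> is singular, the pairing times \<open>sigma x x\<close> is
      the sign of the form at \<open>x + h\<close>; a translation makes its sum independent of
      \<open>h\<close>.\<close>
    have "(\<Sum>x\<in>UNIV. ?b x h * (1 + sigma x x)) =
        (\<Sum>x\<in>UNIV. ?b x h) + (\<Sum>x\<in>UNIV. sigma (x + h) (x + h))"
      using h H by (simp add: distrib_left sum.distrib sigma_add isotropic_def mult_ac)
    also have "(\<Sum>x\<in>UNIV. sigma (x + h) (x + h)) = 2 ^ CARD('n)"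
      using sum_subgrp_translate[OF subgrp_UNIV, of h "\<lambda>x. sigma x x"]
      by (simp add: sum_sigma_diagonal)
    finally show "(\<Sum>x\<in>UNIV. ?b x h * (1 + sigma x x)) =
        (if h = 0 then 2 ^ (2 * CARD('n)) else 0) + 2 ^ CARD('n)"
      by (simp add: sum_commutator)
  qed
  also have "\<dots> = 2 ^ (2 * CARD('n)) + real (card H) * 2 ^ CARD('n)"
    using subgrp_zero[OF H(1)] by (simp add: sum.distrib)
  finally show ?thesis .
qed

lemma isotropic_adjoin_iff:
  assumes "subgrp H" "isotropic H"
  shows "isotropic (adjoin x H) \<longleftrightarrow> x \<in> singular_perp H"
proof -
  have eq: "sigma (x + h) (x + h) = sigma x x * (sigma x h * sigma h x)" if "h \<in> H" for h
    using that assms by (simp add: sigma_add isotropic_def)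
  show ?thesis
  proof
    assume "isotropic (adjoin x H)"
    then have *: "sigma (x + h) (x + h) = 1" if "h \<in> H" for h
      using that by (auto simp: isotropic_def adjoin_def)
    have "sigma x x = 1"
      using *[of 0] assms by (simp add: subgrp_zero)
    then show "x \<in> singular_perp H"
      using * eq by (auto simp: singular_perp_def)
  next
    assume "x \<in> singular_perp H"
    then show "isotropic (adjoin x H)"
      using assms eq by (auto simp: isotropic_def adjoin_def singular_perp_def)
  qed
qed

text \<open>With t = n - j, where n is the dimension of \<open>U\<close>, the quotient of the
  orthogonal complement of \<open>H\<close> by \<open>H\<close> is a plus-type space of dimension
  2t. It has (2^t - 1)(2^(t-1) + 1) nonzero singular vectors, each with 2^j lifts.\<close>

lemma card_isotropic_extensions:
  fixes H :: "('n::finite) pauli_pt set"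
  assumes H: "subgrp H" "isotropic H" "card H = 2 ^ j" and j: "j < CARD('n)"
  shows "card {x. x \<notin> H \<and> isotropic (adjoin x H)} =
    2 ^ j * ((2 ^ (CARD('n) - j) - 1) * (2 ^ (CARD('n) - j - 1) + 1))"
proof -
  \<comment> \<open>All exponents become sums in \<open>j\<close> and \<open>m\<close>, which
    removes the truncated subtraction.\<close>
  define m where "m = CARD('n) - j - 1"
  have n: "CARD('n) = j + m + 1"
    using j by (simp add: m_def)
  then have pow: "(2::nat) ^ CARD('n) = 2 * 2 ^ j * 2 ^ m"
    by (simp add: power_add)
  have "real (2 * 2 ^ j * card (singular_perp H)) = real (2 ^ (2 * CARD('n)) + 2 ^ j * 2 ^ CARD('n))"
    using card_singular_perp_real[OF H(1,2)] H(3) by simp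
  then have "2 * 2 ^ j * card (singular_perp H) = 2 ^ (2 * CARD('n)) + 2 ^ j * 2 ^ CARD('n)"
    by (simp only: of_nat_eq_iff)
  also have "\<dots> = 2 * 2 ^ j * (2 ^ j * (2 * 2 ^ m * 2 ^ m + 2 ^ m))"
    unfolding power_even_eq pow power2_eq_square by (simp add: algebra_simps)
  finally have Z: "card (singular_perp H) = 2 ^ j * (2 * 2 ^ m * 2 ^ m + 2 ^ m)"
    by simp
  have "H \<subseteq> singular_perp H"
    using H sigma_commute[OF H(2,1)] by (auto simp: singular_perp_def isotropic_def)
  moreover have "{x. x \<notin> H \<and> isotropic (adjoin x H)} = singular_perp H - H"
    using isotropic_adjoin_iff[OF H(1,2)] by auto
  ultimately have "card {x. x \<notin> H \<and> isotropic (adjoin x H)} =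
      2 ^ j * (2 * 2 ^ m * 2 ^ m + 2 ^ m) - 2 ^ j"
    by (simp add: card_Diff_subset Z H)
  also have "\<dots> = 2 ^ j * ((2 * 2 ^ m - 1) * (2 ^ m + 1))"
    by (simp add: algebra_simps diff_mult_distrib2)
  finally show ?thesis
    by (simp add: n)
qed

definition isotropic_subgrps :: "nat \<Rightarrow> ('n::finite) pauli_pt set set" where
  "isotropic_subgrps r = {H. subgrp H \<and> card H = 2 ^ r \<and> isotropic H}"

lemma prod_lessThan_add:
  fixes f :: "nat \<Rightarrow> 'a::comm_monoid_mult"
  shows "(\<Prod>j<k + m. f j) = (\<Prod>j<k. f j) * (\<Prod>j<m. f (k + j))"
  by (induction m) (simp_all add: mult_ac)

lemma prod_power_minus_one_nonzero: "(\<Prod>j<m. 2 ^ (m - j) - 1) \<noteq> (0::real)"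
proof -
  have "1 < (2::real) ^ (m - j)" if "j < m" for j
    using that by (intro one_less_power) auto
  then show ?thesis
    by (simp add: less_imp_neq[symmetric])
qed

text \<open>Both sides are the same quotient of 2-factorials,
  \<open>F i / (F k * F (i - k))\<close>.\<close>

lemma gaussian_binomial_symmetric:
  assumes "k \<le> i"
  shows "gaussian_binomial i k = gaussian_binomial i (i - k)"
proof -
  define F :: "nat \<Rightarrow> real" where "F m = (\<Prod>j<m. 2 ^ (m - j) - 1)" for m
  have F: "F m \<noteq> 0" for m
    unfolding F_def by (rule prod_power_minus_one_nonzero)
  have split: "F i = (\<Prod>j<k. 2 ^ (i - j) - 1) * F (i - k)" if "k \<le> i" for k
    using prod_lessThan_add[of "\<lambda>j. 2 ^ (i - j) - 1 :: real" k "i - k"] that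
    by (simp add: F_def)
  have "gaussian_binomial i k = F i / (F k * F (i - k))" if "k \<le> i" for k
    using split[OF that] F[of "i - k"] F[of k]
    by (simp add: gaussian_binomial_def flip: F_def)
  from this[OF assms] this[of "i - k"] assms show ?thesis
    by (simp add: mult.commute)
qed

lemma card_isotropic_subgrps:
  assumes "r \<le> CARD('n)"
  shows "real (card (isotropic_subgrps r :: ('n::finite) pauli_pt set set)) =
    gaussian_binomial CARD('n) r * (\<Prod>j<r. 2 ^ (CARD('n) - j - 1) + 1)"
proof -
  let ?n = "CARD('n)"
  let ?c = "\<lambda>j. 2 ^ j * ((2 ^ (?n - j) - 1) * (2 ^ (?n - j - 1) + 1)) :: nat"
  have flags: "card (isotropic_subgrps r :: 'n pauli_pt set set) * (\<Prod>j<r. 2 ^ r - 2 ^ j) = (\<Prod>j<r. ?c j)"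
    unfolding isotropic_subgrps_def
  proof (rule card_subgrps)
    show "isotropic {0 :: 'n pauli_pt}"
      by (simp add: isotropic_def)
  qed (use assms in \<open>auto intro: isotropic_subset simp: card_isotropic_extensions\<close>)
  \<comment> \<open>Each factor on either side carries \<open>2 ^ j\<close>; once these are split
    off, the number of flags over the number of ordered bases is the Gaussian binomial times the
    remaining product.\<close>
  have pred: "real (2 ^ m - 1) = 2 ^ m - 1" for m
    by (simp add: of_nat_diff)
  have diff: "real (2 ^ r - 2 ^ j) = 2 ^ j * (2 ^ (r - j) - 1)" if "j < r" for j
  proof -
    have "(2::real) ^ r = 2 ^ j * 2 ^ (r - j)"
      using that by (simp flip: power_add)
    moreover have "real (2 ^ r - 2 ^ j) = 2 ^ r - 2 ^ j"
      using that by (subst of_nat_diff) (simp_all add: power_increasing)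
    ultimately show ?thesis
      by (simp only: right_diff_distrib mult_1_right)
  qed
  from flags have "real (card (isotropic_subgrps r :: 'n pauli_pt set set)) * real (\<Prod>j<r. 2 ^ r - 2 ^ j) =
      real (\<Prod>j<r. ?c j)"
    by (simp only: flip: of_nat_mult)
  moreover have "real (\<Prod>j<r. 2 ^ r - 2 ^ j) = (\<Prod>j<r. 2 ^ j) * (\<Prod>j<r. 2 ^ (r - j) - 1)"
    unfolding of_nat_prod prod.distrib[symmetric]
    by (rule prod.cong[OF refl]) (simp only: lessThan_iff diff)
  moreover have "real (\<Prod>j<r. ?c j) =
      (\<Prod>j<r. 2 ^ j) * ((\<Prod>j<r. 2 ^ (?n - j) - 1) * (\<Prod>j<r. 2 ^ (?n - j - 1) + 1))"
    unfolding of_nat_prod prod.distrib[symmetric]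
    by (rule prod.cong[OF refl])
      (simp only: of_nat_mult of_nat_add pred of_nat_power of_nat_numeral of_nat_1)
  ultimately have eq: "real (card (isotropic_subgrps r :: 'n pauli_pt set set)) *
      ((\<Prod>j<r. 2 ^ j) * (\<Prod>j<r. 2 ^ (r - j) - 1)) =
      (\<Prod>j<r. 2 ^ j) * ((\<Prod>j<r. 2 ^ (?n - j) - 1) * (\<Prod>j<r. 2 ^ (?n - j - 1) + 1))"
    by (simp only:)
  have cancel: "N = x / b * y" if "N * (a * b) = a * (x * y)" "a \<noteq> 0" "b \<noteq> 0" for N a b x y :: real
    using that by (simp add: field_simps)
  show ?thesis
    unfolding gaussian_binomial_def
    by (rule cancel[OF eq]) (simp_all only: prod_power_minus_one_nonzero, simp_all)
qed

section \<open>Transfer between coordinates and the quotient group\<close>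

instance ebar :: (finite) char2_group
  by standard (rule ebar_add_self)

definition pauli_class :: "('n::finite) pauli_pt \<Rightarrow> 'n ebar" where
  "pauli_class p = abs_ebar (pauli p)"

lemma pauli_in_E_group: "pauli p \<in> E_group"
  by (simp add: pauli_def XY_in_E_group)

lemma abs_ebar_eq_iff:
  assumes "g \<in> E_group" "h \<in> E_group"
  shows "abs_ebar g = abs_ebar h \<longleftrightarrow> h = g \<or> h = - g"
  using Quotient_rel[OF Quotient_ebar, of g h] assms by (auto simp: ebar_rel_def)

lemma E_group_pauli_cases:
  assumes "g \<in> E_group"
  obtains p where "g = pauli p \<or> g = - pauli p"
proof -
  obtain a b where "g = X_op a ** Y_op b \<or> g = - (X_op a ** Y_op b)"
    using assms by (auto simp: E_group_def)
  then have "g = pauli (a, b) \<or> g = - pauli (a, b)"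
    by (simp add: pauli_def)
  then show thesis
    by (rule that)
qed

lemma minus_matrix_vector_mult: "(- A) *v x = - (A *v x)" for A :: "real ^ 'm ^ 'k"
  by (simp add: matrix_vector_mult_def vec_eq_iff sum_negf)

text \<open>Matrices equal up to sign have nonzero Hilbert-Schmidt product, but those of distinct
  points are orthogonal.\<close>

lemma pauli_eq_up_to_sign:
  fixes p q :: "('n::finite) pauli_pt"
  assumes "pauli q = pauli p \<or> pauli q = - pauli p"
  shows "q = p"
proof -
  have "hs ((*v) (pauli p)) ((*v) (pauli q)) = hs ((*v) (pauli p)) ((*v) (pauli p)) \<or>
      hs ((*v) (pauli p)) ((*v) (pauli q)) = - hs ((*v) (pauli p)) ((*v) (pauli p))"
    using assms by (auto simp: hs_def minus_matrix_vector_mult sum_negf)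
  then show ?thesis
    by (auto simp: hs_pauli split: if_splits)
qed

lemma pauli_class_eq_iff: "pauli_class p = pauli_class q \<longleftrightarrow> p = q"
  unfolding pauli_class_def abs_ebar_eq_iff[OF pauli_in_E_group pauli_in_E_group]
  using pauli_eq_up_to_sign by blast

lemma bij_pauli_class: "bij (pauli_class :: ('n::finite) pauli_pt \<Rightarrow> 'n ebar)"
proof (rule bijI)
  show "inj (pauli_class :: 'n pauli_pt \<Rightarrow> 'n ebar)"
    by (simp add: inj_def pauli_class_eq_iff)
  show "surj (pauli_class :: 'n pauli_pt \<Rightarrow> 'n ebar)"
    unfolding surj_def
  proof
    fix x :: "'n ebar"
    show "\<exists>p. x = pauli_class p"
    proof (induction x rule: ebar.abs_induct)
      case (1 g)
      then have g: "g \<in> E_group"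
        by (simp add: ebar_rel_def)
      then obtain p where "g = pauli p \<or> g = - pauli p"
        by (rule E_group_pauli_cases)
      then have "abs_ebar g = abs_ebar (pauli p)"
        using g by (auto simp: abs_ebar_eq_iff pauli_in_E_group)
      then show ?case
        unfolding pauli_class_def by blast
    qed
  qed
qed

instance ebar :: (finite) finite
proof
  have "(UNIV :: 'a ebar set) = range pauli_class"
    using bij_is_surj[OF bij_pauli_class] by (rule sym)
  then show "finite (UNIV :: 'a ebar set)"
    by (metis finite finite_imageI)
qed

lemma pauli_class_add: "pauli_class (p + q) = pauli_class p + pauli_class q"
proof -
  have "pauli_class p + pauli_class q = abs_ebar (pauli p ** pauli q)"
    by (simp add: pauli_class_def plus_ebar.abs_eq ebar_rel_def pauli_in_E_group)
  also have "\<dots> = pauli_class (p + q)"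
    unfolding pauli_class_def
    using sigma_cases[of p q]
    by (subst abs_ebar_eq_iff)
      (auto simp: pauli_mult pauli_in_E_group minus_in_E_group)
  finally show ?thesis ..
qed

lemma pauli_class_zero: "pauli_class 0 = 0"
  by (simp add: pauli_class_def pauli_zero zero_ebar_def)

lemma ebar_Q_pauli_class: "ebar_Q (pauli_class p) = 0 \<longleftrightarrow> sigma p p = 1"
  by (simp add: pauli_class_def pauli_def ebar_Q_XY sigma_def bit_sign_eq_1_iff
      bit_dot_commute[of "fst p" "snd p"])

lemma ebar_subspace_iff: "ebar.subspace S \<longleftrightarrow> subgrp S"
  by (auto simp: ebar.subspace_def subgrp_def ebar_scale_def)

lemma ex_bit_iff: "(\<exists>c :: bit. P c) \<longleftrightarrow> P 0 \<or> P 1"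
proof
  assume "\<exists>c. P c"
  then obtain c where "P c" ..
  then show "P 0 \<or> P 1"
    by (cases c) auto
qed auto

text \<open>This links linear dimension to cardinality: with 0 and 1 as the only scalars, enlarging
  a span by a vector is \<open>adjoin\<close>.\<close>

lemma ebar_card_span:
  fixes B :: "('n::finite) ebar set"
  shows "ebar.independent B \<Longrightarrow> card (ebar.span B) = 2 ^ card B"
proof (induction B rule: finite_induct[OF finite])
  case (2 b B)
  then have b: "ebar.independent B" "b \<notin> ebar.span B"
    by (auto simp: ebar.independent_insert)
  have "ebar.span (insert b B) = adjoin b (ebar.span B)"
  proof (intro set_eqI)
    fix z
    have "z \<in> ebar.span (insert b B) \<longleftrightarrow> (\<exists>c. z - ebar_scale c b \<in> ebar.span B)"
      by (simp add: ebar.span_insert)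
    also have "\<dots> \<longleftrightarrow> z \<in> ebar.span B \<or> z - b \<in> ebar.span B"
      by (simp add: ex_bit_iff ebar_scale_def)
    finally show "z \<in> ebar.span (insert b B) \<longleftrightarrow> z \<in> adjoin b (ebar.span B)"
      unfolding mem_adjoin_iff minus_ebar_def add.commute[of z b] .
  qed
  moreover have "subgrp (ebar.span B)"
    unfolding ebar_subspace_iff[symmetric] by (rule ebar.subspace_span)
  ultimately have "card (ebar.span (insert b B)) = 2 * card (ebar.span B)"
    using b(2) by (simp only: card_adjoin not_False_eq_True)
  also have "\<dots> = 2 ^ card (insert b B)"
    using 2(1,2) 2(3)[OF b(1)] by simp
  finally show ?case .
qed simp

lemma ebar_dim_iff:
  assumes "subgrp (S :: ('n::finite) ebar set)"
  shows "ebar.dim S = r \<longleftrightarrow> card S = 2 ^ r"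
proof -
  obtain B where B: "B \<subseteq> S" "ebar.independent B" "S \<subseteq> ebar.span B" "card B = ebar.dim S"
    using ebar.basis_exists by blast
  have "ebar.span B = S"
    using B assms by (metis ebar.span_subspace ebar_subspace_iff)
  with ebar_card_span[OF B(2)] have "card S = 2 ^ ebar.dim S"
    by (simp add: B)
  then show ?thesis
    by simp
qed

lemma totally_singular_subspaces_eq:
  "{S :: ('n::finite) ebar set. ebar.subspace S \<and> ebar.dim S = r \<and> totally_singular S} =
     (`) pauli_class ` isotropic_subgrps r"
proof -
  have inj: "inj pauli_class"
    using bij_pauli_class by (rule bij_is_inj)
  have iff: "ebar.subspace (pauli_class ` H) \<and> ebar.dim (pauli_class ` H) = r \<and>
      totally_singular (pauli_class ` H) \<longleftrightarrow> H \<in> isotropic_subgrps r" for H :: "'n pauli_pt set"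
  proof -
    have "subgrp (pauli_class ` H) \<longleftrightarrow> subgrp H"
      unfolding subgrp_def ball_simps
      by (simp only: flip: pauli_class_add pauli_class_zero)
        (simp only: inj_image_mem_iff[OF inj])
    moreover have "card (pauli_class ` H) = card H"
      using inj by (metis card_image inj_on_subset subset_UNIV)
    moreover have "totally_singular (pauli_class ` H) \<longleftrightarrow> isotropic H"
      by (auto simp: totally_singular_def isotropic_def ebar_Q_pauli_class)
    ultimately show ?thesis
      using ebar_dim_iff[of "pauli_class ` H" r]
      by (auto simp: ebar_subspace_iff isotropic_subgrps_def)
  qed
  have sub: "S \<in> (`) pauli_class ` isotropic_subgrps r"
    if S: "ebar.subspace S \<and> ebar.dim S = r \<and> totally_singular S" for S :: "'n ebar set"
  proof (rule image_eqI)
    show eq: "S = pauli_class ` (pauli_class -` S)"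
      by (rule surj_image_vimage_eq[OF bij_is_surj[OF bij_pauli_class], symmetric])
    show "pauli_class -` S \<in> isotropic_subgrps r"
      using S iff[of "pauli_class -` S"] unfolding eq[symmetric] by simp
  qed
  show ?thesis
  proof (intro subset_antisym subsetI)
    fix S :: "'n ebar set"
    assume "S \<in> (`) pauli_class ` isotropic_subgrps r"
    then obtain H where "S = pauli_class ` H" "H \<in> isotropic_subgrps r"
      by (rule imageE)
    then show "S \<in> {S. ebar.subspace S \<and> ebar.dim S = r \<and> totally_singular S}"
      using iff[of H] by (simp only: mem_Collect_eq)
  qed (rule sub, rule CollectD)
qed

lemma ebar_preimage_pauli_class:
  "g \<in> ebar_preimage (pauli_class ` H) \<longleftrightarrow> (\<exists>p\<in>H. g = pauli p \<or> g = - pauli p)"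
proof
  assume "g \<in> ebar_preimage (pauli_class ` H)"
  then obtain p where "p \<in> H" "g \<in> E_group" "abs_ebar (pauli p) = abs_ebar g"
    by (auto simp: ebar_preimage_def pauli_class_def)
  then show "\<exists>p\<in>H. g = pauli p \<or> g = - pauli p"
    by (auto simp: abs_ebar_eq_iff pauli_in_E_group)
next
  assume "\<exists>p\<in>H. g = pauli p \<or> g = - pauli p"
  then obtain p where p: "p \<in> H" "g = pauli p \<or> g = - pauli p"
    by blast
  then have g: "g \<in> E_group"
    by (auto simp: pauli_in_E_group minus_in_E_group)
  have "abs_ebar g = pauli_class p"
    unfolding pauli_class_def using p g by (auto simp: abs_ebar_eq_iff pauli_in_E_group)
  with p g show "g \<in> ebar_preimage (pauli_class ` H)"
    by (auto simp: ebar_preimage_def)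
qed

lemma eigenspace_of_eq:
  assumes "\<And>p. p \<in> H \<Longrightarrow> c (pauli p) = f p" "\<And>p. p \<in> H \<Longrightarrow> c (- pauli p) = - f p"
  shows "eigenspace_of (ebar_preimage (pauli_class ` H)) c = joint_eigenspace H f"
  unfolding eigenspace_of_def joint_eigenspace_def Ball_def ebar_preimage_pauli_class
  using assms by (auto simp: minus_matrix_vector_mult)

text \<open>Restricting a character to the representatives gives a twisted character, the value -1
  at -I turning signs of matrices into signs of numbers. Conversely, a nonzero vector of the
  eigenspace recovers the character.\<close>

lemma invariant_subspaces_eq:
  fixes H :: "('n::finite) pauli_pt set"
  assumes H: "subgrp H" "isotropic H"
  shows "invariant_subspaces (ebar_preimage (pauli_class ` H)) = joint_eigenspace H ` twisted_chars H"
proof (intro set_eqI iffI)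
  let ?S = "ebar_preimage (pauli_class ` H)"
  have S: "pauli p \<in> ?S" "- pauli p \<in> ?S" if "p \<in> H" for p
    using that by (auto simp: ebar_preimage_pauli_class)
  have oneS: "- mat 1 \<in> ?S"
    using S(2)[OF subgrp_zero[OF H(1)]] by (simp add: pauli_zero)
  {
    fix W assume "W \<in> invariant_subspaces ?S"
    then obtain c where c: "is_character ?S c" "c (- mat 1) = - 1" and W: "W = eigenspace_of ?S c"
      by (auto simp: invariant_subspaces_def)
    have mult: "c (g ** h) = c g * c h" if "g \<in> ?S" "h \<in> ?S" for g h
      using c that by (simp add: is_character_def)
    have neg: "c (- pauli p) = - c (pauli p)" if "p \<in> H" for p
      using mult[OF oneS S(1)[OF that]] c by (simp add: E_group_mult_minus)
    \<comment> \<open>The value 1 off \<open>H\<close> is the normalisation required by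
      \<open>twisted_chars\<close>.\<close>
    define f where "f p = (if p \<in> H then c (pauli p) else 1)" for p
    have "f (p + q) = sigma p q * f p * f q" if "p \<in> H" "q \<in> H" for p q
      using mult[OF S(1)[OF that(1)] S(1)[OF that(2)]] neg[OF subgrp_add[OF H(1) that]]
        sigma_cases[of p q] that H
      by (auto simp: f_def pauli_mult subgrp_add)
    moreover have "f p = 1 \<or> f p = - 1" if "p \<in> H" for p
      using c S(1)[OF that] that by (auto simp: f_def is_character_def)
    ultimately have "f \<in> twisted_chars H"
      by (auto simp: twisted_chars_def twisted_char_def) (simp add: f_def)
    moreover have "W = joint_eigenspace H f"
      unfolding W by (rule eigenspace_of_eq) (simp_all add: f_def neg)
    ultimately show "W \<in> joint_eigenspace H ` twisted_chars H"
      by blast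
  next
    fix W assume "W \<in> joint_eigenspace H ` twisted_chars H"
    then obtain f where f: "twisted_char H f" and W: "W = joint_eigenspace H f"
      by (auto simp: twisted_chars_def)
    have "dim W \<noteq> 0"
    proof
      assume "dim W = 0"
      with dim_joint_eigenspace[OF H f] have "(2::real) ^ CARD('n) = 0"
        by (simp only: W of_nat_0 mult_zero_left)
      then show False
        by simp
    qed
    then obtain w where w: "w \<in> W" "w \<noteq> 0"
      by (metis dim_eq_0 singleton_iff subsetI)
    \<comment> \<open>The eigenvalue of \<open>g\<close> on \<open>w\<close>, written as a quotient
      so that no decomposition of \<open>g\<close> into a sign and a representative must be chosen.
      Multiplicativity follows by acting on \<open>w\<close> twice.\<close>
    define c where "c g = (g *v w) \<bullet> w / (w \<bullet> w)" for g
    have act: "pauli p *v w = f p *\<^sub>R w" if "p \<in> H" for p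
      using that w by (simp add: W joint_eigenspace_def)
    have c: "c (pauli p) = f p" "c (- pauli p) = - f p" if "p \<in> H" for p
      using w by (simp_all add: c_def minus_matrix_vector_mult act[OF that])
    have cw: "g *v w = c g *\<^sub>R w" if "g \<in> ?S" for g
      using that by (auto simp: ebar_preimage_pauli_class c act minus_matrix_vector_mult)
    have "c (g ** h) = c g * c h" if "g \<in> ?S" "h \<in> ?S" for g h
    proof -
      have "(g ** h) *v w = (c g * c h) *\<^sub>R w"
        using that by (simp add: cw matrix_vector_mult_scaleR mult.commute
            flip: matrix_vector_mul_assoc)
      then show ?thesis
        using w by (simp add: c_def[of "g ** h"])
    qed
    moreover have "c g \<in> {1, - 1}" if "g \<in> ?S" for g
      using that twisted_char_cases[OF f] by (fastforce simp: ebar_preimage_pauli_class c)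
    ultimately have "is_character ?S c"
      by (simp add: is_character_def)
    moreover have "c (- mat 1) = - 1"
      using w by (simp add: c_def minus_matrix_vector_mult)
    moreover have "W = eigenspace_of ?S c"
      unfolding W by (rule eigenspace_of_eq[symmetric]) (simp_all add: c)
    ultimately show "W \<in> invariant_subspaces ?S"
      by (auto simp: invariant_subspaces_def)
  }
qed

section \<open>The packing\<close>

lemma isotropic_subgrpsD:
  "H \<in> isotropic_subgrps r \<Longrightarrow> subgrp H" "H \<in> isotropic_subgrps r \<Longrightarrow> isotropic H"
  "H \<in> isotropic_subgrps r \<Longrightarrow> card H = 2 ^ r"
  by (simp_all add: isotropic_subgrps_def)

lemma twisted_charsD: "f \<in> twisted_chars H \<Longrightarrow> twisted_char H f"
  by (simp add: twisted_chars_def)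

lemma dim_joint_eigenspace_eq:
  fixes H :: "('n::finite) pauli_pt set"
  assumes "H \<in> isotropic_subgrps r" "twisted_char H f" "CARD('n) = k + r"
  shows "dim (joint_eigenspace H f) = 2 ^ k"
proof -
  have "real (dim (joint_eigenspace H f)) * 2 ^ r = 2 ^ k * 2 ^ r"
    using dim_joint_eigenspace[OF isotropic_subgrpsD(1,2)[OF assms(1)] assms(2)]
      isotropic_subgrpsD(3)[OF assms(1)] assms(3)
    by (simp add: power_add)
  then have "real (dim (joint_eigenspace H f)) = real (2 ^ k)"
    by simp
  then show ?thesis
    by (simp only: of_nat_eq_iff)
qed

lemma grass_dist_joint_eigenspace:
  fixes H K :: "('n::finite) pauli_pt set"
  assumes H: "H \<in> isotropic_subgrps r" "twisted_char H f"
    and K: "K \<in> isotropic_subgrps r" "twisted_char K g" and n: "CARD('n) = k + r"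
  shows "grass_dist (joint_eigenspace H f) (joint_eigenspace K g) =
    sqrt (2 ^ k - hs (eigenprojection H f) (eigenprojection K g))"
proof -
  have "grass_dist (joint_eigenspace H f) (joint_eigenspace K g) =
      sqrt (real (2 ^ k) - hs (eigenprojection H f) (eigenprojection K g))"
    using assms isotropic_subgrpsD
    by (intro grass_dist_eq subspace_joint_eigenspace dim_joint_eigenspace_eq
        orth_proj_onto_eigenprojection)
  then show ?thesis
    by simp
qed

text \<open>If the characters disagree somewhere on \<open>H \<inter> K\<close>, the trace is 0. If
  they agree, then \<open>H \<noteq> K\<close>, because equal groups would force
  \<open>f = g\<close>; so the intersection has index at least two in \<open>H\<close>.\<close>

lemma hs_eigenprojection_le:
  fixes H K :: "('n::finite) pauli_pt set"
  assumes H: "H \<in> isotropic_subgrps r" "f \<in> twisted_chars H"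
    and K: "K \<in> isotropic_subgrps r" "g \<in> twisted_chars K" and n: "CARD('n) = k + r"
    and neq: "(H, f) \<noteq> (K, g)"
  shows "hs (eigenprojection H f) (eigenprojection K g) \<le> 2 ^ k / 2"
proof -
  note H' = isotropic_subgrpsD[OF H(1)] and K' = isotropic_subgrpsD[OF K(1)]
  have hs: "hs (eigenprojection H f) (eigenprojection K g) =
      2 ^ k / 2 ^ r * (if \<forall>p\<in>H \<inter> K. f p = g p then real (card (H \<inter> K)) else 0)"
    using hs_eigenprojection[OF H'(1) twisted_charsD[OF H(2)] K'(1) twisted_charsD[OF K(2)]]
    by (simp add: H' K' n power_add)
  show ?thesis
  proof (cases "\<forall>p\<in>H \<inter> K. f p = g p")
    case True
    have "H \<noteq> K"
    proof
      assume "H = K"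
      then have "f = g"
        using True H(2) K(2) by (intro ext) (metis (mono_tags, lifting) IntI mem_Collect_eq twisted_chars_def)
      with \<open>H = K\<close> neq show False
        by simp
    qed
    moreover have "H \<subseteq> K \<Longrightarrow> H = K"
      using H'(3) K'(3) by (intro card_subset_eq) auto
    ultimately have "H \<inter> K \<subset> H"
      by blast
    then have "2 * card (H \<inter> K) \<le> card H"
      by (intro card_psubset_subgrp subgrp_Int H' K')
    then have "2 * real (card (H \<inter> K)) \<le> 2 ^ r"
      unfolding H' by (metis of_nat_le_iff of_nat_mult of_nat_numeral of_nat_power)
    then have "2 ^ k / 2 ^ r * real (card (H \<inter> K)) \<le> 2 ^ k / 2 ^ r * (2 ^ r / 2 :: real)"
      by (intro mult_left_mono) simp_all
    with True show ?thesis
      by (simp add: hs)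
  qed (auto simp: hs)
qed

text \<open>Equal planes would have trace \<open>2 ^ k\<close>, exceeding the bound of half of it
  for distinct pairs.\<close>

lemma inj_on_joint_eigenspace:
  assumes n: "CARD('n) = k + r"
  shows "inj_on (\<lambda>(H, f). joint_eigenspace H f)
    (SIGMA H:isotropic_subgrps r :: ('n::finite) pauli_pt set set. twisted_chars H)"
proof (rule inj_onI, clarify)
  fix H K :: "'n pauli_pt set" and f g
  assume H: "H \<in> isotropic_subgrps r" "f \<in> twisted_chars H"
    and K: "K \<in> isotropic_subgrps r" "g \<in> twisted_chars K"
    and eq: "joint_eigenspace H f = joint_eigenspace K g"
  have "hs (eigenprojection H f) (eigenprojection K g) = real (dim (joint_eigenspace H f))"
    using orth_proj_onto_eigenprojection[OF isotropic_subgrpsD(1,2)[OF H(1)] twisted_charsD[OF H(2)]]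
      orth_proj_onto_eigenprojection[OF isotropic_subgrpsD(1,2)[OF K(1)] twisted_charsD[OF K(2)]]
    unfolding eq[symmetric] by (intro hs_same subspace_joint_eigenspace)
  also have "\<dots> = 2 ^ k"
    using dim_joint_eigenspace_eq[OF H(1) twisted_charsD[OF H(2)] n] by simp
  finally have "\<not> hs (eigenprojection H f) (eigenprojection K g) \<le> 2 ^ k / 2"
    by simp
  then have "(H, f) = (K, g)"
    using hs_eigenprojection_le[OF H K n] by blast
  then show "H = K \<and> f = g"
    by simp
qed

section \<open>Coordinate subspaces and a pair of planes at minimal distance\<close>

definition supported_in :: "'n set \<Rightarrow> (bit ^ 'n::finite) set" where
  "supported_in J = {a. \<forall>j. j \<notin> J \<longrightarrow> a $ j = 0}"

lemma card_supported_in: "card (supported_in J) = 2 ^ card J"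
proof -
  have "bij_betw (\<lambda>a. {j. a $ j = 1}) (supported_in J) (Pow J)"
    by (rule bij_betw_byWitness[where f' = "\<lambda>A. \<chi> j. if j \<in> A then 1 else 0"])
      (auto simp: supported_in_def vec_eq_iff)
  then show ?thesis
    by (simp add: bij_betw_same_card card_Pow)
qed

lemma subgrp_supported_in: "subgrp (supported_in I \<times> supported_in J)"
  by (auto simp: subgrp_def supported_in_def zero_prod_def)

text \<open>Disjoint supports make every term of the dot product vanish. Such products are therefore
  isotropic, and the constant function 1 is a twisted character on them.\<close>

lemma sigma_supported_in:
  assumes "I \<inter> J = {}" "p \<in> supported_in I \<times> supported_in J" "q \<in> supported_in I \<times> supported_in J"
  shows "sigma p q = 1"
proof -
  have "snd p $ j * fst q $ j = 0" for j
    using assms by (cases "j \<in> I") (auto simp: supported_in_def)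
  then show ?thesis
    by (simp only: sigma_def bit_sign_eq_1_iff bit_dot_def sum.neutral_const)
qed

text \<open>The bound on the overlap is attained by the preimages of \<open>X(a)\<close>, \<open>a\<close> supported in an
  \<open>r\<close>-set \<open>J\<close>, and of \<open>X(a) Y(b)\<close>, where for one \<open>j \<in> J\<close> the support of \<open>a\<close> avoids \<open>j\<close> and that
  of \<open>b\<close> is contained in \<open>{j}\<close>.\<close>

lemma attaining_pair_exists:
  assumes n: "CARD('n) = k + r" and r: "r \<noteq> 0"
  obtains H K :: "('n::finite) pauli_pt set" and f g where
    "H \<in> isotropic_subgrps r" "f \<in> twisted_chars H" "K \<in> isotropic_subgrps r"
    "g \<in> twisted_chars K" "(H, f) \<noteq> (K, g)"
    "hs (eigenprojection H f) (eigenprojection K g) = 2 ^ k / 2"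
proof -
  obtain J :: "'n set" where J: "card J = r"
    using obtain_subset_with_card_n[of r "UNIV :: 'n set"] n by auto
  then obtain j where j: "j \<in> J"
    using r by fastforce
  define A B where "A = (supported_in J \<times> supported_in {} :: 'n pauli_pt set)"
    and "B = (supported_in (J - {j}) \<times> supported_in {j} :: 'n pauli_pt set)"
  obtain s where s: "r = Suc s"
    using r not0_implies_Suc by blast
  have cj: "card (J - {j}) = s"
    using j J s by simp
  have sA: "sigma p q = 1" if "p \<in> A" "q \<in> A" for p q
    using that sigma_supported_in[of J "{}"] by (auto simp: A_def)
  have sB: "sigma p q = 1" if "p \<in> B" "q \<in> B" for p q
    using that sigma_supported_in[of "J - {j}" "{j}"] by (auto simp: B_def)
  have card: "card A = 2 ^ r" "card B = 2 ^ r"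
    by (simp_all add: A_def B_def card_cartesian_product card_supported_in J cj s)
  have A: "A \<in> isotropic_subgrps r" and B: "B \<in> isotropic_subgrps r"
    using subgrp_supported_in card sA sB
    by (auto simp: isotropic_subgrps_def isotropic_def A_def B_def)
  have tA: "(\<lambda>_. 1) \<in> twisted_chars A" and tB: "(\<lambda>_. 1) \<in> twisted_chars B"
    using sA sB by (auto simp: twisted_chars_def twisted_char_def)
  \<comment> \<open>The common elements are the shifts supported in \<open>J - {j}\<close>, of index
    exactly two in both groups.\<close>
  have "A \<inter> B = supported_in (J - {j}) \<times> supported_in {}"
    by (auto simp: A_def B_def supported_in_def)
  then have cAB: "card (A \<inter> B) = 2 ^ s"
    by (simp add: card_cartesian_product card_supported_in cj)
  have "A \<noteq> B"
    using cAB card by (auto simp: s)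
  moreover have "hs (eigenprojection A (\<lambda>_. 1)) (eigenprojection B (\<lambda>_. 1)) = 2 ^ k / 2"
    using hs_eigenprojection[OF isotropic_subgrpsD(1)[OF A] twisted_charsD[OF tA]
        isotropic_subgrpsD(1)[OF B] twisted_charsD[OF tB]]
    by (simp add: card cAB n power_add s)
  ultimately show thesis
    using that[OF A tA B tB] by blast
qed

theorem theorem1:
  fixes i k :: nat and \<P> :: "(real ^ (bit ^ 'n::finite)) set set"
  assumes "i = CARD('n)" and "k \<le> i - 1"
    and "\<P> = (\<Union>S\<in>{S :: 'n ebar set. ebar.subspace S \<and> ebar.dim S = i - k \<and> totally_singular S}.
                invariant_subspaces (ebar_preimage S))"
  shows "is_packing (2 ^ k) \<P> \<and>
         real (card \<P>) = 2 ^ (i - k) * gaussian_binomial i k * (\<Prod>j=k..i - 1. (2 ^ j + 1)) \<and>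
         min_distance \<P> = 2 powr ((real k - 1) / 2)"
proof -
  define r where "r = i - k"
  have i: "i > 0"
    using assms(1) by simp
  \<comment> \<open>Since \<open>i\<close> is positive, the truncated bound
    \<open>k \<le> i - 1\<close> really gives \<open>k < i\<close>, hence
    \<open>r \<noteq> 0\<close>.\<close>
  have n: "CARD('n) = k + r" and r: "r \<noteq> 0" and ik: "k \<le> i"
    using assms(2) i unfolding r_def assms(1)[symmetric] by linarith+
  let ?T = "isotropic_subgrps r :: 'n pauli_pt set set"
  let ?I = "SIGMA H:?T. twisted_chars H"
  have "\<P> = (\<Union>H\<in>?T. invariant_subspaces (ebar_preimage (pauli_class ` H)))"
    unfolding assms(3) r_def[symmetric] totally_singular_subspaces_eq by blast
  also have "\<dots> = (\<Union>H\<in>?T. joint_eigenspace H ` twisted_chars H)"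
    using isotropic_subgrpsD by (intro SUP_cong refl invariant_subspaces_eq)
  finally have P: "\<P> = (\<lambda>(H, f). joint_eigenspace H f) ` ?I"
    by auto
  have card_tw: "card (twisted_chars H) = 2 ^ r" if "H \<in> ?T" for H
    using isotropic_subgrpsD[OF that] by (rule card_twisted_chars)
  then have fin_tw: "finite (twisted_chars H)" if "H \<in> ?T" for H
    using that by (metis card.infinite power_not_zero zero_neq_numeral)
  then have "finite ?I"
    by (intro finite_SigmaI) auto
  then have fin: "finite \<P>"
    by (simp add: P)
  have "is_packing (2 ^ k) \<P>"
    using fin dim_joint_eigenspace_eq[OF _ twisted_charsD n]
    by (auto simp: is_packing_def P grassmannian_def subspace_joint_eigenspace)
  moreover have "real (card \<P>) = 2 ^ (i - k) * gaussian_binomial i k * (\<Prod>j=k..i - 1. (2 ^ j + 1))"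
  proof -
    have "card \<P> = card ?I"
      unfolding P by (rule card_image[OF inj_on_joint_eigenspace[OF n]])
    also have "\<dots> = card ?T * 2 ^ r"
      using card_tw fin_tw by (subst card_SigmaI) auto
    finally have "real (card \<P>) = 2 ^ r * real (card ?T)"
      by simp
    also have "real (card ?T) = gaussian_binomial i r * (\<Prod>j<r. 2 ^ (i - j - 1) + 1)"
      using card_isotropic_subgrps[where r = r and 'n = 'n] n assms(1) by simp
    also have "gaussian_binomial i r = gaussian_binomial i k"
      using gaussian_binomial_symmetric[OF ik] by (simp add: r_def)
    \<comment> \<open>The reversal \<open>j \<mapsto> i - j - 1\<close> is its own inverse and
      exchanges the two index ranges.\<close>
    also have "(\<Prod>j<r. 2 ^ (i - j - 1) + 1) = (\<Prod>j=k..i - 1. 2 ^ j + 1 :: real)"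
      by (rule prod.reindex_bij_witness[where i = "\<lambda>j. i - j - 1" and j = "\<lambda>j. i - j - 1"])
        (use i in \<open>auto simp: r_def\<close>)
    finally show ?thesis
      by (simp add: r_def)
  qed
  moreover have "min_distance \<P> = 2 powr ((real k - 1) / 2)"
  proof -
    let ?D = "{grass_dist P Q | P Q. P \<in> \<P> \<and> Q \<in> \<P> \<and> P \<noteq> Q}"
    \<comment> \<open>The radicand \<open>2 ^ k / 2\<close> is the dimension \<open>2 ^ k\<close>
      minus the largest possible trace \<open>2 ^ k / 2\<close>.\<close>
    have sqrt: "2 powr ((real k - 1) / 2) = sqrt (2 ^ k / 2)"
      by (simp add: powr_half_sqrt_powr powr_diff powr_realpow)
    have "?D \<subseteq> (\<lambda>(P, Q). grass_dist P Q) ` (\<P> \<times> \<P>)"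
      by auto
    then have "finite ?D"
      by (rule finite_subset) (use fin in simp)
    moreover have "sqrt (2 ^ k / 2) \<le> d" if "d \<in> ?D" for d
    proof -
      obtain P Q where PQ: "P \<in> \<P>" "Q \<in> \<P>" "P \<noteq> Q" and d: "d = grass_dist P Q"
        using \<open>d \<in> ?D\<close> by blast
      obtain H f where H: "H \<in> ?T" "f \<in> twisted_chars H" and P': "P = joint_eigenspace H f"
        using PQ(1) unfolding P by auto
      obtain K g where K: "K \<in> ?T" "g \<in> twisted_chars K" and Q': "Q = joint_eigenspace K g"
        using PQ(2) unfolding P by auto
      have neq: "(H, f) \<noteq> (K, g)"
        using PQ(3) P' Q' by auto
      have d: "d = grass_dist (joint_eigenspace H f) (joint_eigenspace K g)"
        by (simp only: d P' Q')
      then show ?thesis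
        using hs_eigenprojection_le[OF H K n neq]
        by (simp add: grass_dist_joint_eigenspace[OF H(1) twisted_charsD[OF H(2)]
              K(1) twisted_charsD[OF K(2)] n])
    qed
    moreover have "sqrt (2 ^ k / 2) \<in> ?D"
    proof -
      obtain H K :: "'n pauli_pt set" and f g where H: "H \<in> ?T" "f \<in> twisted_chars H"
        and K: "K \<in> ?T" "g \<in> twisted_chars K" and neq: "(H, f) \<noteq> (K, g)"
        and hs: "hs (eigenprojection H f) (eigenprojection K g) = 2 ^ k / 2"
        by (rule attaining_pair_exists[OF n r]) (rule that)
      have "joint_eigenspace H f \<noteq> joint_eigenspace K g"
        using inj_onD[OF inj_on_joint_eigenspace[OF n], of "(H, f)" "(K, g)"] H K neq by auto
      moreover have "joint_eigenspace H f \<in> \<P>" "joint_eigenspace K g \<in> \<P>"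
        using H K by (auto simp: P)
      moreover have "grass_dist (joint_eigenspace H f) (joint_eigenspace K g) = sqrt (2 ^ k / 2)"
        by (simp add: hs grass_dist_joint_eigenspace[OF H(1) twisted_charsD[OF H(2)]
              K(1) twisted_charsD[OF K(2)] n])
      ultimately show ?thesis
        unfolding mem_Collect_eq
        by (intro exI[of _ "joint_eigenspace H f"] exI[of _ "joint_eigenspace K g"]) simp
    qed
    ultimately show ?thesis
      unfolding min_distance_def sqrt by (intro Min_eqI) auto
  qed
  ultimately show ?thesis
    by blast
qed

end
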